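(* Given an $n$-node graph $G$ with an unknown girth $g$, there exists a deterministic algorithm in the Congested Clique model that runs in $O(1)$ rounds and outputs an integer $a$ such that $g \in \{a, a+1\}$.
   Context: The girth of a graph is the length of its shortest cycle. Congested Clique model: the $n$ vertices of the input graph $G$ are $n$ synchronous processors; in each round every pair of processors may exchange a message of $O(\log n)$ bits (all-to-all communication, independent of the edges of $G$). Initially each node knows only the edges of $G$ incident to it. The round complexity is the number of communication rounds. *)

theory Defs
  imports
    Complex_Main
    "HOL-Library.Extended_Nat"
    "Graph_Theory.Graph_Theory"
begin

text \<open>
  An undirected simple graph is a \<^locale>\<open>pair_graph\<close>: finite, loop-free, with a symmetric set of
  arcs. The predicate \<^const>\<open>pre_digraph.cycle\<close> admits closed walks of any positive length, so the
  walk \<open>u, v, u\<close> along one undirected edge counts as a cycle there; the bound \<open>3 \<le> length p\<close> excludes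
  exactly these. The infimum over the empty set is \<open>\<infinity>\<close>, the girth of a forest.
\<close>

definition girth :: "'a pair_pre_digraph \<Rightarrow> enat" where
  "girth G = (INF p \<in> {p. pre_digraph.cycle (with_proj G) p \<and> 3 \<le> length p}. enat (length p))"

definition neighbours :: "'a pair_pre_digraph \<Rightarrow> 'a \<Rightarrow> 'a set" where
  "neighbours G v = {u. (v, u) \<in> parcs G}"

text \<open>
  The processors of an \<open>n\<close>-vertex input are \<open>0, \<dots>, n - 1\<close>. Messages are bit strings, and an inbox
  maps each sender to the message received from it in one round. As local computation is
  deterministic and unrestricted, the state of a processor may be taken to be everything it has seen:
  \<open>n\<close>, its own identifier, its neighbours in the input graph, and its inboxes from all earlier rounds
  (so the length of that list tells it the current round). In \<open>send A n v N h w\<close>, processor \<open>v\<close> with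
  neighbourhood \<open>N\<close> and inboxes \<open>h\<close> sends the resulting message to \<open>w\<close>; \<open>result A n v N h\<close> is the
  output of \<open>v\<close> if it stops after having seen \<open>h\<close>. One algorithm serves all \<open>n\<close>.
\<close>

type_synonym inbox = "nat \<Rightarrow> bool list"

record 'out cc_algorithm =
  send :: "nat \<Rightarrow> nat \<Rightarrow> nat set \<Rightarrow> inbox list \<Rightarrow> nat \<Rightarrow> bool list"
  result :: "nat \<Rightarrow> nat \<Rightarrow> nat set \<Rightarrow> inbox list \<Rightarrow> 'out"

definition cc_input :: "nat \<Rightarrow> nat pair_pre_digraph \<Rightarrow> bool" where
  "cc_input n G \<longleftrightarrow> pair_graph G \<and> pverts G = {..<n}"

primrec cc_history ::
  "'out cc_algorithm \<Rightarrow> nat \<Rightarrow> nat pair_pre_digraph \<Rightarrow> nat \<Rightarrow> nat \<Rightarrow> inbox list" where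
  "cc_history A n G 0 v = []"
| "cc_history A n G (Suc r) v = cc_history A n G r v @
     [\<lambda>u. if u < n \<and> u \<noteq> v then send A n u (neighbours G u) (cc_history A n G r u) v else []]"

definition cc_message ::
  "'out cc_algorithm \<Rightarrow> nat \<Rightarrow> nat pair_pre_digraph \<Rightarrow> nat \<Rightarrow> nat \<Rightarrow> nat \<Rightarrow> bool list" where
  "cc_message A n G r u v = send A n u (neighbours G u) (cc_history A n G r u) v"

definition cc_output ::
  "'out cc_algorithm \<Rightarrow> nat \<Rightarrow> nat pair_pre_digraph \<Rightarrow> nat \<Rightarrow> nat \<Rightarrow> 'out" where
  "cc_output A n G R v = result A n v (neighbours G v) (cc_history A n G R v)"

definition cc_bandwidth ::
  "'out cc_algorithm \<Rightarrow> nat \<Rightarrow> nat pair_pre_digraph \<Rightarrow> nat \<Rightarrow> real \<Rightarrow> bool" where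
  "cc_bandwidth A n G R b \<longleftrightarrow>
     (\<forall>r<R. \<forall>u<n. \<forall>v<n. u \<noteq> v \<longrightarrow> real (length (cc_message A n G r u v)) \<le> b)"

end

theory Submission
  imports Defs "HOL-Number_Theory.Cong"
begin

text \<open>
  Let \<open>m\<close> be the number of arcs. If \<open>m = O(n)\<close>, every processor learns the whole graph. If the
  vertices of degree above \<open>2 * sqrt n\<close> carry more than \<open>2 * n\<close> arcs, two of them have two common
  neighbours, so the girth is \<open>3\<close> or \<open>4\<close>; otherwise their arcs are made public. In the remaining
  case let \<open>d\<close> be half the average degree and \<open>d ^ k < n \<le> d ^ (k + 1)\<close>. By the Moore bound the girth is
  at most \<open>2 * k + 2\<close>, so it suffices to find the shortest cycle among those of length at most \<open>2 * k\<close>.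

  For this, split the vertices into \<open>k * s\<close> groups of equal total degree, \<open>s\<close> of order \<open>sqrt d\<close>, and give
  each processor two families \<open>T\<close>, \<open>T'\<close> of \<open>k\<close> groups each; there are \<open>((k * s) choose k)\<^sup>2 \<le> n\<close> such pairs.
  It collects the arcs from \<open>T'\<close> into \<open>T\<close>. For the even vertices of a short cycle in \<open>T\<close> and
  their successors in \<open>T'\<close> these are all arcs of the cycle. The groups on the side of \<open>T'\<close> are
  balanced anew for every \<open>T\<close>, by the number of arcs into \<open>T\<close>; so a processor collects
  \<open>O(m / s\<^sup>2) = O(n)\<close> arcs, which can be routed to it deterministically in \<open>O(1)\<close> rounds.
\<close>

section \<open>Composing algorithms\<close>

text \<open>A cycle search up to length \<open>2 * k\<close> suffices because failure leaves only
  the girths \<open>2 * k + 1\<close> and \<open>2 * k + 2\<close>, so \<open>2 * k + 1\<close> is a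
  valid output. The obstacle is the load. A partition fixed in advance by degrees bounds the arcs
  into \<open>T\<close> by about \<open>m / s\<close>, but all of these may come from the same few
  groups, so a fixed partition on the other side need not gain a second factor \<open>s\<close>.
  Balancing by the arcs into \<open>T\<close> forces it. A group may exceed its quota by the weight
  of one vertex. This is why large degrees are removed: with degrees of order \<open>sqrt n\<close>,
  the excess of \<open>k\<close> groups is of order \<open>k * sqrt n\<close>, and this is at most
  of order \<open>n\<close> because \<open>k\<close> is at most the number of families, whose square
  is at most \<open>n\<close>. The size of \<open>s\<close> comes from counting: the number of pairs
  is at most \<open>(9 * s ^ 2) ^ k\<close>, which has to stay below \<open>n\<close>, so
  \<open>9 * s ^ 2 \<le> d\<close> is required; with \<open>s\<close> as large as this permits,
  \<open>m / s ^ 2\<close> is of order \<open>n\<close>.\<close>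

definition cc_computable :: "(nat \<Rightarrow> nat pair_pre_digraph \<Rightarrow> nat \<Rightarrow> 'a) \<Rightarrow> bool" where
  "cc_computable f \<longleftrightarrow> (\<exists>(A :: 'a cc_algorithm) R c. \<forall>n G. cc_input n G \<longrightarrow>
     cc_bandwidth A n G R (c * log 2 (real n)) \<and> (\<forall>v<n. cc_output A n G R v = f n G v))"

lemma cc_history_cong:
  "send A = send B \<Longrightarrow> cc_history A n G r v = cc_history B n G r v"
  by (induction r arbitrary: v) auto

lemma length_cc_history [simp]: "length (cc_history A n G r v) = r"
  by (induction r) auto

lemma cc_bandwidth_mono: "cc_bandwidth A n G R b \<Longrightarrow> b \<le> b' \<Longrightarrow> cc_bandwidth A n G R b'"
  unfolding cc_bandwidth_def by fastforce

lemma log_le_log_mult: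
  assumes "c \<le> c'" shows "c * log 2 (real n) \<le> c' * log 2 (real n)"
proof (cases "n = 0")
  case True
  then show ?thesis by (simp add: log_def)
next
  case False
  then have "0 \<le> log 2 (real n)" by simp
  then show ?thesis using assms by (rule mult_right_mono[rotated])
qed

lemma cc_computable_neighbours: "cc_computable (\<lambda>n G v. neighbours G v)"
proof -
  define A :: "nat set cc_algorithm" where "A = \<lparr>send = \<lambda>_ _ _ _ _. [], result = \<lambda>n v N h. N\<rparr>"
  have "\<forall>n G. cc_input n G \<longrightarrow> cc_bandwidth A n G 0 (0 * log 2 (real n)) \<and>
    (\<forall>v<n. cc_output A n G 0 v = neighbours G v)"
    by (auto simp: A_def cc_bandwidth_def cc_output_def)
  then show ?thesis unfolding cc_computable_def by blast
qed

text \<open>Values of computable functions are knowledge, not messages: they may be sets or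
  functions of any size. Local work changes only \<open>result\<close>, so rounds, histories and
  bandwidth stay the same.\<close>

lemma cc_computable_local:
  assumes "cc_computable f"
  shows "cc_computable (\<lambda>n G v. g n v (f n G v))"
proof -
  from assms obtain A R c where A: "\<And>n G. cc_input n G \<Longrightarrow>
     cc_bandwidth A n G R (c * log 2 (real n)) \<and> (\<forall>v<n. cc_output A n G R v = f n G v)"
    unfolding cc_computable_def by blast
  define B where "B = \<lparr>send = send A, result = \<lambda>n v N h. g n v (result A n v N h)\<rparr>"
  have hist: "cc_history B n G r v = cc_history A n G r v" for n G r v
    by (rule cc_history_cong) (simp add: B_def)
  have "\<forall>n G. cc_input n G \<longrightarrow>
     cc_bandwidth B n G R (c * log 2 (real n)) \<and> (\<forall>v<n. cc_output B n G R v = g n v (f n G v))"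
    using A by (auto simp: cc_bandwidth_def cc_output_def cc_message_def hist) (auto simp: B_def)
  then show ?thesis unfolding cc_computable_def by blast
qed

text \<open>The second algorithm runs after the first and sees only the inboxes from round
  \<open>R1\<close> on, as if started afresh. The length of the inbox list serves as the
  clock.\<close>

lemma cc_computable_pair:
  assumes "cc_computable f" "cc_computable g"
  shows "cc_computable (\<lambda>n G v. (f n G v, g n G v))"
proof -
  from assms(1) obtain A1 R1 c1 where A1: "\<And>n G. cc_input n G \<Longrightarrow>
     cc_bandwidth A1 n G R1 (c1 * log 2 (real n)) \<and> (\<forall>v<n. cc_output A1 n G R1 v = f n G v)"
    unfolding cc_computable_def by blast
  from assms(2) obtain A2 R2 c2 where A2: "\<And>n G. cc_input n G \<Longrightarrow>
     cc_bandwidth A2 n G R2 (c2 * log 2 (real n)) \<and> (\<forall>v<n. cc_output A2 n G R2 v = g n G v)"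
    unfolding cc_computable_def by blast
  define B where "B = \<lparr>send = \<lambda>n v N h w. if length h < R1 then send A1 n v N h w
        else send A2 n v N (drop R1 h) w,
      result = \<lambda>n v N h. (result A1 n v N (take R1 h), result A2 n v N (drop R1 h))\<rparr>"
  define c where "c = max c1 c2"
  have h1: "cc_history B n G r v = cc_history A1 n G r v" if "r \<le> R1" for n G r v
    using that by (induction r arbitrary: v) (auto simp: B_def)
  have h2: "cc_history B n G (R1 + r) v = cc_history A1 n G R1 v @ cc_history A2 n G r v" for n G r v
    by (induction r arbitrary: v) (auto simp: h1, auto simp: B_def)
  have m1: "cc_message B n G r u v = cc_message A1 n G r u v" if "r < R1" for n G r u v
    using that by (simp add: cc_message_def h1) (simp add: B_def)
  have m2: "cc_message B n G (R1 + r) u v = cc_message A2 n G r u v" for n G r u v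
    by (simp add: cc_message_def h2) (simp add: B_def)
  have "cc_bandwidth B n G (R1 + R2) (c * log 2 (real n)) \<and>
      (\<forall>v<n. cc_output B n G (R1 + R2) v = (f n G v, g n G v))" if "cc_input n G" for n G
  proof (intro conjI allI impI)
    have b1: "cc_bandwidth A1 n G R1 (c * log 2 (real n))"
      by (rule cc_bandwidth_mono[OF conjunct1[OF A1[OF that]] log_le_log_mult]) (simp add: c_def)
    have b2: "cc_bandwidth A2 n G R2 (c * log 2 (real n))"
      by (rule cc_bandwidth_mono[OF conjunct1[OF A2[OF that]] log_le_log_mult]) (simp add: c_def)
    show "cc_bandwidth B n G (R1 + R2) (c * log 2 (real n))"
      unfolding cc_bandwidth_def
    proof (intro allI impI)
      fix r u v assume *: "r < R1 + R2" "u < n" "v < n" "u \<noteq> v"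
      show "real (length (cc_message B n G r u v)) \<le> c * log 2 (real n)"
      proof (cases "r < R1")
        case True
        then show ?thesis using b1 * by (simp add: m1 cc_bandwidth_def)
      next
        case False
        then obtain r' where r: "r = R1 + r'" using le_Suc_ex not_less by blast
        then show ?thesis using b2 * by (simp add: m2 cc_bandwidth_def)
      qed
    qed
  next
    fix v assume "v < n"
    then show "cc_output B n G (R1 + R2) v = (f n G v, g n G v)"
      using A1[OF that] A2[OF that] by (simp add: cc_output_def h2) (simp add: B_def)
  qed
  then show ?thesis unfolding cc_computable_def by blast
qed

lemma cc_computable_local2:
  assumes "cc_computable f" "cc_computable g"
  shows "cc_computable (\<lambda>n G v. h n v (f n G v) (g n G v))"
  using cc_computable_local[OF cc_computable_pair[OF assms], of "\<lambda>n v (x, y). h n v x y"] by simp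

lemma cc_computable_local3:
  assumes "cc_computable f" "cc_computable g" "cc_computable k"
  shows "cc_computable (\<lambda>n G v. h n v (f n G v) (g n G v) (k n G v))"
  using cc_computable_local2[OF assms(1) cc_computable_pair[OF assms(2,3)],
    of "\<lambda>n v x (y, z). h n v x y z"] by simp

lemma cc_computable_cong:
  assumes "cc_computable f" "\<And>n G v. cc_input n G \<Longrightarrow> v < n \<Longrightarrow> f n G v = g n G v"
  shows "cc_computable g"
proof -
  from assms(1) obtain A R c where A: "\<And>n G. cc_input n G \<Longrightarrow>
     cc_bandwidth A n G R (c * log 2 (real n)) \<and> (\<forall>v<n. cc_output A n G R v = f n G v)"
    unfolding cc_computable_def by blast
  have "\<forall>n G. cc_input n G \<longrightarrow>
     cc_bandwidth A n G R (c * log 2 (real n)) \<and> (\<forall>v<n. cc_output A n G R v = g n G v)"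
    using A assms(2) by simp
  then show ?thesis unfolding cc_computable_def by blast
qed

text \<open>Binary words of a fixed length, \<open>c\<close> times the rounded up logarithm, are
  numerous enough. For \<open>n \<ge> 2\<close> the logarithm is at least \<open>1\<close>, so
  rounding up at most doubles it; hence the factor \<open>2\<close>. The code depends on
  \<open>n\<close> alone, so all processors share it.\<close>

lemma ex_short_code:
  fixes S :: "nat \<Rightarrow> 'm set"
  assumes "\<And>n. n \<ge> 2 \<Longrightarrow> finite (S n) \<and> card (S n) \<le> n ^ c"
  obtains e :: "nat \<Rightarrow> 'm \<Rightarrow> bool list" where
    "\<And>n. n \<ge> 2 \<Longrightarrow> inj_on (e n) (S n)"
    "\<And>n x. n \<ge> 2 \<Longrightarrow> x \<in> S n \<Longrightarrow> real (length (e n x)) \<le> real (2 * c) * log 2 (real n)"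
proof -
  have ex: "\<exists>e :: 'm \<Rightarrow> bool list. inj_on e (S n) \<and> (\<forall>x\<in>S n. real (length (e x)) \<le> real (2 * c) * log 2 (real n))"
    if n2: "n \<ge> 2" for n
  proof -
    define l where "l = nat \<lceil>log 2 (real n)\<rceil>"
    have pos: "log 2 (real n) \<ge> 1" using n2 by simp
    have l: "log 2 (real n) \<le> real l" "real l \<le> 2 * log 2 (real n)"
      using pos unfolding l_def by linarith+
    have "real n = 2 powr (log 2 (real n))" using n2 by simp
    also have "\<dots> \<le> 2 powr (real l)" using l by simp
    also have "\<dots> = real (2 ^ l)" by (simp add: powr_realpow)
    finally have "n \<le> 2 ^ l" by linarith
    then have "n ^ c \<le> 2 ^ (l * c)" by (simp add: power_mult power_mono)
    moreover have "card {bs :: bool list. set bs \<subseteq> UNIV \<and> length bs = l * c} = 2 ^ (l * c)"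
      by (subst card_lists_length_eq) auto
    ultimately have "card (S n) \<le> card {bs :: bool list. set bs \<subseteq> UNIV \<and> length bs = l * c}"
      using assms[OF n2] by linarith
    then obtain e where e: "inj_on e (S n)" "e ` S n \<subseteq> {bs :: bool list. set bs \<subseteq> UNIV \<and> length bs = l * c}"
      using assms[OF n2] finite_lists_length_eq[of "UNIV :: bool set" "l * c"]
        inj_on_iff_card_le[of "S n" "{bs :: bool list. set bs \<subseteq> UNIV \<and> length bs = l * c}"] by auto
    have "real (l * c) \<le> real (2 * c) * log 2 (real n)"
      using mult_right_mono[OF l(2), of "real c"] by (simp add: mult_ac)
    moreover have "length (e x) = l * c" if "x \<in> S n" for x using e(2) that by blast
    ultimately show ?thesis using e(1) by auto
  qed
  then have "\<forall>n. \<exists>e :: 'm \<Rightarrow> bool list. n \<ge> 2 \<longrightarrow> inj_on e (S n) \<and> (\<forall>x\<in>S n. real (length (e x)) \<le> real (2 * c) * log 2 (real n))"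
    by blast
  then obtain e :: "nat \<Rightarrow> 'm \<Rightarrow> bool list" where "\<forall>n. n \<ge> 2 \<longrightarrow> inj_on (e n) (S n) \<and>
      (\<forall>x\<in>S n. real (length (e n x)) \<le> real (2 * c) * log 2 (real n))"
    by metis
  then show thesis using that by blast
qed

text \<open>A message outside the polynomially large alphabet is replaced by \<^term>\<open>None\<close>, so that the
  bandwidth bound holds on every input.\<close>

lemma cc_computable_exchange:
  fixes M :: "nat \<Rightarrow> nat pair_pre_digraph \<Rightarrow> nat \<Rightarrow> nat \<Rightarrow> 'm"
  assumes M: "cc_computable M"
    and S: "\<And>n. n \<ge> 2 \<Longrightarrow> finite (S n) \<and> card (S n) \<le> n ^ c"
  shows "cc_computable (\<lambda>n G w u. if u < n \<and> M n G u w \<in> S n then Some (M n G u w) else None)"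
proof -
  define S' where "S' n = insert None (Some ` S n)" for n
  \<comment> \<open>The additional symbol \<open>None\<close> costs one in the exponent.\<close>
  have "finite (S' n) \<and> card (S' n) \<le> n ^ (Suc c)" if "n \<ge> 2" for n
  proof -
    have "card (S' n) \<le> Suc (card (S n))"
      unfolding S'_def using S[OF that] by (simp add: card_insert_if card_image)
    also have "\<dots> \<le> n ^ c + n ^ c" using S[OF that] one_le_power[of n c] that by linarith
    also have "\<dots> \<le> n * n ^ c" using mult_le_mono1[OF that] by (simp only: mult_2)
    finally show ?thesis using S[OF that] by (simp add: S'_def)
  qed
  then obtain e :: "nat \<Rightarrow> 'm option \<Rightarrow> bool list" where
    inj: "\<And>n. n \<ge> 2 \<Longrightarrow> inj_on (e n) (S' n)" and
    len: "\<And>n x. n \<ge> 2 \<Longrightarrow> x \<in> S' n \<Longrightarrow> real (length (e n x)) \<le> real (2 * Suc c) * log 2 (real n)"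
    using ex_short_code[of S' "Suc c"] by blast
  from M obtain A R cA where A: "\<And>n G. cc_input n G \<Longrightarrow>
     cc_bandwidth A n G R (cA * log 2 (real n)) \<and> (\<forall>v<n. cc_output A n G R v = M n G v)"
    unfolding cc_computable_def by blast
  define clip where "clip n m = (if m \<in> S n then Some m else None)" for n m
  have clip: "clip n m \<in> S' n" for n m by (auto simp: clip_def S'_def)
  \<comment> \<open>The model delivers nothing from a processor to itself. Therefore the entry
    \<open>u = v\<close> is recomputed locally from the first \<open>R\<close> inboxes, and only the
    other entries are decoded from the last inbox.\<close>
  define B where "B = \<lparr>send = \<lambda>n v N h w. if length h < R then send A n v N h w
        else e n (clip n (result A n v N h w)),
      result = \<lambda>n v N h u. if u = v then clip n (result A n v N (take R h) u)
        else if u < n then the_inv_into (S' n) (e n) (last h u) else None\<rparr>"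
  define b where "b = max cA (real (2 * Suc c))"
  have h1: "cc_history B n G r v = cc_history A n G r v" if "r \<le> R" for n G r v
    using that by (induction r arbitrary: v) (auto simp: B_def)
  have m1: "cc_message B n G r u v = cc_message A n G r u v" if "r < R" for n G r u v
    using that by (simp add: cc_message_def h1) (simp add: B_def)
  have m2: "cc_message B n G R u v = e n (clip n (cc_output A n G R u v))" for n G u v
    by (simp add: cc_message_def h1) (simp add: B_def cc_output_def)
  have h2: "cc_history B n G (Suc R) v = cc_history A n G R v @
      [\<lambda>u. if u < n \<and> u \<noteq> v then cc_message B n G R u v else []]" for n G v
    by (simp add: h1 cc_message_def fun_eq_iff)
  have "cc_bandwidth B n G (Suc R) (b * log 2 (real n)) \<and>
      (\<forall>v<n. cc_output B n G (Suc R) v =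
        (\<lambda>u. if u < n \<and> M n G u v \<in> S n then Some (M n G u v) else None))"
    if inp: "cc_input n G" for n G
  proof (intro conjI allI impI ext)
    have b1: "cc_bandwidth A n G R (b * log 2 (real n))"
      by (rule cc_bandwidth_mono[OF conjunct1[OF A[OF that]] log_le_log_mult]) (simp add: b_def)
    show "cc_bandwidth B n G (Suc R) (b * log 2 (real n))"
      unfolding cc_bandwidth_def
    proof (intro allI impI)
      fix r u v assume *: "r < Suc R" "u < n" "v < n" "u \<noteq> v"
      show "real (length (cc_message B n G r u v)) \<le> b * log 2 (real n)"
      proof (cases "r < R")
        case True
        then show ?thesis using b1 * by (simp add: m1 cc_bandwidth_def)
      next
        case False
        with * have r: "r = R" and "n \<ge> 2" by auto
        then have "real (length (cc_message B n G r u v)) \<le> real (2 * Suc c) * log 2 (real n)"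
          using len clip by (simp add: m2)
        also have "\<dots> \<le> b * log 2 (real n)" by (rule log_le_log_mult) (simp add: b_def)
        finally show ?thesis .
      qed
    qed
  next
    fix v u assume v: "v < n"
    have out: "cc_output B n G (Suc R) v u = (if u = v then clip n (M n G v v)
        else if u < n then the_inv_into (S' n) (e n) (e n (clip n (M n G u v))) else None)"
    proof -
      have R: "result A n v (neighbours G v) (cc_history A n G R v) = M n G v"
        using A[OF inp] v by (simp add: cc_output_def)
      have "cc_output B n G (Suc R) v u = (if u = v then clip n (M n G v v)
        else if u < n then the_inv_into (S' n) (e n) (if u < n \<and> u \<noteq> v then cc_message B n G R u v else []) else None)"
        unfolding cc_output_def h2 by (simp add: B_def R cong: if_cong)
      then show ?thesis using A[OF inp] by (simp add: m2)
    qed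
    show "cc_output B n G (Suc R) v u = (if u < n \<and> M n G u v \<in> S n then Some (M n G u v) else None)"
    proof (cases "u = v \<or> \<not> u < n")
      case True
      then show ?thesis using v by (auto simp: out clip_def)
    next
      case False
      with v have "n \<ge> 2" by auto
      with False show ?thesis
        by (simp add: out the_inv_into_f_f[OF inj clip]) (simp add: clip_def)
    qed
  qed
  then show ?thesis unfolding cc_computable_def by blast
qed

lemma cc_computable_exchange_nat:
  assumes "cc_computable M"
  shows "cc_computable (\<lambda>n G w u. if u < n \<and> M n G u w < n ^ c then M n G u w else 0)"
  by (rule cc_computable_cong[OF cc_computable_local[OF
        cc_computable_exchange[OF assms, of "\<lambda>n. {..<n ^ c}" c],
      of "\<lambda>n v m u. case m u of None \<Rightarrow> 0 | Some x \<Rightarrow> x"]]) (simp_all add: fun_eq_iff)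

text \<open>A nonempty set of at most \<open>K\<close> elements is the set of a list of length
  exactly \<open>K\<close>, padded by repeating an element. The empty set accounts for the
  \<open>+ 1\<close>.\<close>

lemma card_bounded_subsets_le:
  assumes "finite U" "K \<ge> 1" "card U \<ge> 1"
  shows "finite {X. X \<subseteq> U \<and> card X \<le> K} \<and> card {X. X \<subseteq> U \<and> card X \<le> K} \<le> card U ^ K + 1"
proof -
  let ?L = "{xs. set xs \<subseteq> U \<and> length xs = K}"
  have "{X. X \<subseteq> U \<and> card X \<le> K} \<subseteq> insert {} (set ` ?L)"
  proof
    fix X assume X: "X \<in> {X. X \<subseteq> U \<and> card X \<le> K}"
    show "X \<in> insert {} (set ` ?L)"
    proof (cases "X = {}")
      case False
      have "finite X" using X assms(1) finite_subset by auto
      then obtain xs where xs: "set xs = X" "distinct xs" using finite_distinct_list by blast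
      then have len: "length xs = card X" by (metis distinct_card)
      obtain x where x: "x \<in> X" using False by blast
      have "set (xs @ replicate (K - card X) x) = X" using xs x by auto
      moreover have "length (xs @ replicate (K - card X) x) = K" using len X by auto
      ultimately have "X = set (xs @ replicate (K - card X) x)"
        "xs @ replicate (K - card X) x \<in> ?L" using X by auto
      then show ?thesis by blast
    qed auto
  qed
  moreover have fin: "finite ?L" using assms(1) by (rule finite_lists_length_eq)
  moreover have "card (insert {} (set ` ?L)) \<le> Suc (card ?L)"
    using fin card_image_le[OF fin, of set] by (simp add: card_insert_if)
  moreover have "card ?L = card U ^ K" using assms(1) by (rule card_lists_length_eq)
  ultimately have "card {X. X \<subseteq> U \<and> card X \<le> K} \<le> card U ^ K + 1"
    using card_mono[of "insert {} (set ` ?L)" "{X. X \<subseteq> U \<and> card X \<le> K}"] by simp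
  then show ?thesis using assms(1) by simp
qed

text \<open>Since \<open>K\<close> is a constant, sets of at most \<open>K\<close> items from a
  polynomially large universe again form a polynomially large alphabet. A set outside it arrives as
  \<open>{}\<close>.\<close>

lemma cc_computable_exchange_set:
  fixes U :: "nat \<Rightarrow> 'm set"
  assumes M: "cc_computable M"
    and U: "\<And>n. n \<ge> 2 \<Longrightarrow> finite (U n) \<and> card (U n) \<le> n ^ c"
  shows "cc_computable (\<lambda>n G w u. if u < n \<and> M n G u w \<subseteq> U n \<and> card (M n G u w) \<le> K
           then M n G u w else {})"
proof -
  have "finite {X. X \<subseteq> U n \<and> card X \<le> K} \<and> card {X. X \<subseteq> U n \<and> card X \<le> K} \<le> n ^ (c * Suc K + 1)"
    if "n \<ge> 2" for n
  proof (cases "card (U n) \<ge> 1")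
    case True
    have fin: "finite (U n)" using U[OF that] by simp
    \<comment> \<open>\<open>Suc K\<close> in place of \<open>K\<close> covers \<open>K = 0\<close>,
      which the counting lemma excludes.\<close>
    have *: "finite {X. X \<subseteq> U n \<and> card X \<le> Suc K} \<and> card {X. X \<subseteq> U n \<and> card X \<le> Suc K} \<le> card (U n) ^ Suc K + 1"
      by (rule card_bounded_subsets_le[OF fin _ True]) simp
    have sub: "{X. X \<subseteq> U n \<and> card X \<le> K} \<subseteq> {X. X \<subseteq> U n \<and> card X \<le> Suc K}" by auto
    have "card {X. X \<subseteq> U n \<and> card X \<le> K} \<le> card (U n) ^ Suc K + 1"
      using card_mono[OF conjunct1[OF *] sub] conjunct2[OF *] by (rule le_trans)
    also have "\<dots> \<le> (n ^ c) ^ Suc K + 1" using U[OF that] by (simp add: power_mono del: power_Suc)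
    also have "\<dots> = n ^ (c * Suc K) + 1" by (simp only: power_mult)
    also have "\<dots> \<le> n ^ (c * Suc K) + n ^ (c * Suc K)" using that by simp
    also have "\<dots> \<le> n * n ^ (c * Suc K)" using mult_le_mono1[OF that] by (simp only: mult_2)
    finally show ?thesis using finite_subset[OF sub conjunct1[OF *]] by simp
  next
    case False
    then have "U n = {}" using U[OF that] by (auto simp: Suc_le_eq)
    then have "{X. X \<subseteq> U n \<and> card X \<le> K} = {{}}" by auto
    then show ?thesis using that by simp
  qed
  then show ?thesis
    by (intro cc_computable_cong[OF cc_computable_local[OF
          cc_computable_exchange[OF M, of "\<lambda>n. {X. X \<subseteq> U n \<and> card X \<le> K}" "c * Suc K + 1"],
        of "\<lambda>n v m u. case m u of None \<Rightarrow> {} | Some x \<Rightarrow> x"]]) (simp_all add: fun_eq_iff)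
qed

section \<open>Cycles, girth and the Moore bound\<close>

text \<open>Stated for bare arc sets, because a set of arcs is all that a processor learns about the
  graph.\<close>

definition is_cycle :: "'a rel \<Rightarrow> 'a list \<Rightarrow> bool" where
  "is_cycle E vs \<longleftrightarrow> 3 \<le> length vs \<and> distinct vs \<and>
     (\<forall>i<length vs. (vs ! i, vs ! (Suc i mod length vs)) \<in> E)"

definition rel_girth :: "'a rel \<Rightarrow> enat" where
  "rel_girth E = (INF vs \<in> {vs. is_cycle E vs}. enat (length vs))"

lemma rel_girth_le: "is_cycle E vs \<Longrightarrow> rel_girth E \<le> enat (length vs)"
  unfolding rel_girth_def by (rule INF_lower) simp

lemma rel_girth_greatest:
  "(\<And>vs. is_cycle E vs \<Longrightarrow> b \<le> enat (length vs)) \<Longrightarrow> b \<le> rel_girth E"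
  unfolding rel_girth_def by (rule INF_greatest) simp

lemma rel_girth_ge_3: "3 \<le> rel_girth E"
  by (rule rel_girth_greatest) (auto simp: is_cycle_def numeral_eq_enat)

lemma is_cycle_mono: "is_cycle E vs \<Longrightarrow> E \<subseteq> F \<Longrightarrow> is_cycle F vs"
  unfolding is_cycle_def by blast

text \<open>Partial knowledge is safe: a processor that knows only some of the arcs may overestimate
  the girth but never underestimates it.\<close>

lemma rel_girth_antimono: "E \<subseteq> F \<Longrightarrow> rel_girth F \<le> rel_girth E"
  by (rule rel_girth_greatest) (blast intro: rel_girth_le is_cycle_mono)

lemma rel_girth_attained:
  assumes "rel_girth E \<noteq> \<infinity>"
  obtains vs where "is_cycle E vs" "rel_girth E = enat (length vs)"
proof -
  let ?X = "(\<lambda>vs. enat (length vs)) ` {vs. is_cycle E vs}"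
  have "?X \<noteq> {}" using assms by (auto simp: rel_girth_def top_enat_def[symmetric])
  then have "Inf ?X \<in> ?X" by (meson Inf_enat_def LeastI_ex ex_in_conv wellorder_InfI)
  then show thesis using that unfolding rel_girth_def by auto
qed

section \<open>Agreement with the girth defined by closed arc walks\<close>

lemma pcas_iff:
  assumes "p \<noteq> []"
  shows "pcas u p v \<longleftrightarrow> fst (p ! 0) = u \<and> snd (last p) = v \<and>
    (\<forall>i. Suc i < length p \<longrightarrow> snd (p ! i) = fst (p ! Suc i))"
  using assms
proof (induction p arbitrary: u)
  case (Cons e p)
  show ?case
  proof (cases "p = []")
    case True
    then show ?thesis by (cases e) auto
  next
    case False
    then show ?thesis
      by (cases e) (auto simp: Cons.IH nth_Cons less_Suc_eq_0_disj split: nat.splits)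
  qed
qed simp

lemma girth_eq_rel_girth:
  assumes "pair_graph G"
  shows "girth G = rel_girth (parcs G)"
proof -
  interpret pair_graph G by fact
  have "(\<lambda>p. enat (length p)) ` {p. cycle p \<and> 3 \<le> length p} =
        (\<lambda>vs. enat (length vs)) ` {vs. is_cycle (parcs G) vs}" (is "?L = ?R")
  proof (intro equalityI subsetI)
    fix x assume "x \<in> ?L"
    then obtain p where p: "cycle p" "3 \<le> length p" "x = enat (length p)" by auto
    then obtain u where u: "awalk u p u" "distinct (tl (pawalk_verts u p))" "p \<noteq> []"
      unfolding cycle_def by auto
    have cas: "fst (p ! 0) = u" "snd (last p) = u"
        "\<And>i. Suc i < length p \<Longrightarrow> snd (p ! i) = fst (p ! Suc i)"
      using u(1) pcas_iff[OF u(3), of u u] unfolding awalk_def by auto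
    have "pawalk_verts u p = map fst p @ [u]"
      using awalk_verts_conv[of u p] u(3) cas(2) by simp
    then have "distinct (tl (map fst p) @ [u])" using u(2,3) by simp
    moreover have "map fst p = u # tl (map fst p)"
      using u(3) cas(1) by (cases p) auto
    \<comment> \<open>Distinctness is known for the vertices after the first one. As the walk is
      closed, rotating \<open>u\<close> from the end to the front yields the list of tails.\<close>
    ultimately have "distinct (map fst p)" by (metis distinct1_rotate rotate1.simps(2))
    moreover have "(map fst p ! i, map fst p ! (Suc i mod length (map fst p))) \<in> parcs G"
      if "i < length (map fst p)" for i
    proof -
      have i: "i < length p" using that by simp
      have "map fst p ! (Suc i mod length p) = snd (p ! i)"
      proof (cases "Suc i < length p")
        case True
        then show ?thesis using cas(3) by simp
      next
        case False
        then have "Suc i = length p" "i = length p - 1" using i by simp_all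
        then show ?thesis using cas(1,2) u(3) by (simp add: last_conv_nth)
      qed
      moreover have "p ! i \<in> parcs G" using u(1) nth_mem[OF i] unfolding awalk_def by blast
      ultimately show ?thesis using i by simp
    qed
    ultimately have "is_cycle (parcs G) (map fst p)"
      unfolding is_cycle_def using p(2) by simp
    then show "x \<in> ?R" using p(3) by (metis imageI length_map mem_Collect_eq)
  next
    fix x assume "x \<in> ?R"
    then obtain vs where vs: "is_cycle (parcs G) vs" "x = enat (length vs)" by auto
    then have len: "3 \<le> length vs" and dist: "distinct vs"
      and arc: "\<And>i. i < length vs \<Longrightarrow> (vs ! i, vs ! (Suc i mod length vs)) \<in> parcs G"
      by (auto simp: is_cycle_def)
    define p where "p = map (\<lambda>i. (vs ! i, vs ! (Suc i mod length vs))) [0..<length vs]"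
    have lp: "length p = length vs" by (simp add: p_def)
    have pi: "p ! i = (vs ! i, vs ! (Suc i mod length vs))" if "i < length vs" for i
      using that by (simp add: p_def)
    have pne: "p \<noteq> []" and pos: "0 < length vs" using lp len by auto
    have "pcas (vs ! 0) p (vs ! 0)"
      using pos lp pne by (auto simp: pcas_iff pi last_conv_nth)
    moreover have sub: "set p \<subseteq> parcs G" using arc by (auto simp: p_def)
    moreover have "vs ! 0 \<in> pverts G" using arc[OF pos] by (rule in_arcsD1)
    ultimately have "awalk (vs ! 0) p (vs ! 0)" unfolding awalk_def by simp
    moreover have "map fst p = vs" using lp pi by (auto intro!: nth_equalityI)
    then have "pawalk_verts (vs ! 0) p = vs @ [snd (last p)]"
      using awalk_verts_conv[of "vs ! 0" p] pne by simp
    then have "pawalk_verts (vs ! 0) p = vs @ [vs ! 0]"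
      using pos lp pne by (simp add: last_conv_nth pi)
    then have "distinct (tl (pawalk_verts (vs ! 0) p))"
      using dist len by (cases vs) auto
    ultimately have "cycle p" unfolding cycle_def using pne by auto
    then show "x \<in> ?L" using lp len vs(2) by (intro image_eqI[of _ _ p]) auto
  qed
  then show ?thesis unfolding girth_def rel_girth_def by simp
qed

text \<open>Take the shortest return \<open>f i = f (i + m)\<close> inside the walk. Minimality
  makes the vertices in between distinct; \<open>m = 1\<close> would be a loop and
  \<open>m = 2\<close> a backtracking step.\<close>

lemma closed_nonbacktracking_walk_imp_cycle:
  fixes f :: "nat \<Rightarrow> 'a"
  assumes irr: "irrefl E" and L: "L \<ge> 1" and closed: "f 0 = f L"
    and E: "\<And>i. i < L \<Longrightarrow> (f i, f (Suc i)) \<in> E"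
    and nb: "\<And>i. i + 2 \<le> L \<Longrightarrow> f i \<noteq> f (i + 2)"
  obtains vs where "is_cycle E vs" "length vs \<le> L"
proof -
  define P where "P m \<longleftrightarrow> m \<ge> 1 \<and> (\<exists>i. i + m \<le> L \<and> f i = f (i + m))" for m
  define m where "m = (LEAST m. P m)"
  have "P L" using L closed by (auto simp: P_def intro: exI[of _ 0])
  then have Pm: "P m" and least: "\<And>k. k < m \<Longrightarrow> \<not> P k"
    unfolding m_def by (auto intro: LeastI dest: not_less_Least)
  from Pm obtain i where i: "m \<ge> 1" "i + m \<le> L" "f i = f (i + m)" by (auto simp: P_def)
  have "m \<noteq> 1" using E[of i] irr i by (auto simp: irrefl_def)
  moreover have "m \<noteq> 2" using nb[of i] i by auto
  ultimately have m3: "m \<ge> 3" using i by simp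
  define vs where "vs = map (\<lambda>j. f (i + j)) [0..<m]"
  have "distinct vs"
  proof -
    have "f (i + a) \<noteq> f (i + b)" if "a < b" "b < m" for a b
    proof
      assume "f (i + a) = f (i + b)"
      then have "P (b - a)" using that i unfolding P_def by (auto intro!: exI[of _ "i + a"])
      moreover have "b - a < m" using that by simp
      ultimately show False using least by blast
    qed
    then have "inj_on (\<lambda>j. f (i + j)) {0..<m}" by (auto intro!: linorder_inj_onI')
    then show ?thesis by (simp add: vs_def distinct_map)
  qed
  moreover have "(vs ! j, vs ! (Suc j mod length vs)) \<in> E" if "j < length vs" for j
  proof -
    have j: "j < m" using that by (simp add: vs_def)
    have "f (i + Suc j mod m) = f (Suc (i + j))"
    proof (cases "Suc j < m")
      case False
      then have "Suc j = m" using j by simp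
      then show ?thesis using i(3) by (metis add_Suc_right mod_self add_0_right)
    qed simp
    then show ?thesis using E[of "i + j"] i j by (simp add: vs_def)
  qed
  ultimately have "is_cycle E vs" using m3 by (simp add: is_cycle_def vs_def)
  moreover have "length vs \<le> L" using i by (simp add: vs_def)
  ultimately show thesis by (rule that)
qed

text \<open>The two walks are glued at the vertex just before their first difference. There the next
  vertices \<open>v ! j\<close> and \<open>w ! j\<close> differ, so the glued walk does not
  backtrack. At the common end it may do so, but that is where the closed walk starts, and the walk
  lemma imposes no condition there.\<close>

lemma distinct_nonbacktracking_walks_imp_cycle:
  fixes v w :: "'a list"
  assumes irr: "irrefl E" and sym: "sym E" and ne: "v \<noteq> w"
    and len: "length v = Suc k" "length w = Suc k" and ends: "hd v = hd w" "last v = last w"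
    and v: "\<And>i. i < k \<Longrightarrow> (v ! i, v ! Suc i) \<in> E" "\<And>i. i + 2 \<le> k \<Longrightarrow> v ! i \<noteq> v ! (i + 2)"
    and w: "\<And>i. i < k \<Longrightarrow> (w ! i, w ! Suc i) \<in> E" "\<And>i. i + 2 \<le> k \<Longrightarrow> w ! i \<noteq> w ! (i + 2)"
  obtains vs where "is_cycle E vs" "length vs \<le> 2 * k"
proof -
  define j where "j = (LEAST j. v ! j \<noteq> w ! j)"
  have "\<exists>j. v ! j \<noteq> w ! j" using ne len nth_equalityI[of v w] by auto
  then have j: "v ! j \<noteq> w ! j" unfolding j_def by (rule LeastI_ex)
  have eq: "v ! i = w ! i" if "i < j" for i using not_less_Least[of i] that unfolding j_def by blast
  have "\<exists>j<Suc k. v ! j \<noteq> w ! j" using ne len nth_equalityI[of v w] by auto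
  then have jk: "j \<le> k" using eq by (metis less_Suc_eq_le not_less order.strict_trans2)
  have "v ! 0 = w ! 0" using ends(1) len by (metis hd_conv_nth list.size(3) nat.distinct(1))
  then have j0: "j \<ge> 1" using j by (cases j) auto
  have lst: "v ! k = w ! k" using ends(2) len by (metis last_conv_nth list.size(3) nat.distinct(1) diff_Suc_1)
  then have jk': "j < k" using j jk by (cases "j = k") auto
  text \<open>Walk along \<open>v\<close> from its end back to the last common vertex of the two walks, then along
    \<open>w\<close> to its end.\<close>
  define m where "m = k + 1 - j"
  define f where "f i = (if i \<le> m then v ! (k - i) else w ! (j - 1 + (i - m)))" for i
  have mk: "k - m = j - 1" "m \<ge> 2" "m \<le> k" using j0 jk' by (auto simp: m_def)
  have fm: "f i = w ! (j - 1 + (i - m))" if "i \<ge> m" for i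
    using that eq[of "j - 1"] j0 mk by (cases "i = m") (auto simp: f_def)
  have "f 0 = f (2 * m)"
  proof -
    have "j - 1 + (2 * m - m) = k" using j0 jk' by (simp add: m_def)
    then show ?thesis using lst mk by (simp add: f_def)
  qed
  moreover have "(f i, f (Suc i)) \<in> E" if "i < 2 * m" for i
  proof (cases "i < m")
    case True
    then have "k - i = Suc (k - Suc i)" "k - Suc i < k" using mk by auto
    then have "(v ! (k - i), v ! (k - Suc i)) \<in> E" using v(1)[of "k - Suc i"] sym by (auto simp: sym_def)
    then show ?thesis using True by (simp add: f_def)
  next
    case False
    then have "j - 1 + (Suc i - m) = Suc (j - 1 + (i - m))" "j - 1 + (i - m) < k"
      using that j0 jk' by (auto simp: m_def)
    then show ?thesis using w(1)[of "j - 1 + (i - m)"] False by (simp add: fm)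
  qed
  moreover have "f i \<noteq> f (i + 2)" if "i + 2 \<le> 2 * m" for i
  proof -
    consider "i + 2 \<le> m" | "Suc i = m" | "i \<ge> m" by linarith
    then show ?thesis
    proof cases
      case 1
      then have "k - i = (k - (i + 2)) + 2" "(k - (i + 2)) + 2 \<le> k" using mk by auto
      then have "v ! (k - i) \<noteq> v ! (k - (i + 2))" using v(2)[of "k - (i + 2)"] by metis
      then show ?thesis using 1 by (simp add: f_def)
    next
      case 2
      then have "k - i = j" "j - 1 + (i + 2 - m) = j" using j0 jk' by (auto simp: m_def)
      then show ?thesis using j 2 by (simp add: fm) (simp add: f_def)
    next
      case 3
      then have "j - 1 + (i + 2 - m) = j - 1 + (i - m) + 2" "j - 1 + (i - m) + 2 \<le> k"
        using that j0 jk' by (auto simp: m_def)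
      then show ?thesis using w(2)[of "j - 1 + (i - m)"] 3 by (simp add: fm)
    qed
  qed
  ultimately obtain vs where "is_cycle E vs" "length vs \<le> 2 * m"
    using closed_nonbacktracking_walk_imp_cycle[OF irr, of "2 * m" f] mk by auto
  then show thesis using that[of vs] mk by simp
qed

text \<open>The Moore bound by counting walks: more than \<open>d ^ k\<close> nonbacktracking walks
  of \<open>k\<close> steps end in a fixed root, yet they start in at most \<open>d ^ k\<close>
  vertices. Two of them share both ends.\<close>

lemma min_degree_imp_short_cycle:
  fixes E :: "'a rel"
  assumes irr: "irrefl E" and sym: "sym E" and fin: "finite S" and ne: "S \<noteq> {}"
    and deg: "\<And>v. v \<in> S \<Longrightarrow> d < card {u \<in> S. (u, v) \<in> E}"
    and d: "d \<ge> 1" and k: "k \<ge> 1" and card: "card S \<le> d ^ k"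
  obtains vs where "is_cycle E vs" "length vs \<le> 2 * k"
proof -
  obtain r where r: "r \<in> S" using ne by blast
  define W where "W j = {w. length w = Suc j \<and> set w \<subseteq> S \<and> last w = r \<and>
    (\<forall>i<j. (w ! i, w ! Suc i) \<in> E) \<and> (\<forall>i. i + 2 \<le> j \<longrightarrow> w ! i \<noteq> w ! (i + 2))}" for j
  have finW: "finite (W j)" for j
    by (rule finite_subset[OF _ finite_lists_length_eq[OF fin, of "Suc j"]]) (auto simp: W_def)
  \<comment> \<open>Walks grow at the head. Avoiding the vertex \<open>w ! 1\<close> costs one
    neighbour, so a degree above \<open>d\<close> leaves at least \<open>d\<close>
    extensions.\<close>
  define X where "X w = {u \<in> S. (u, hd w) \<in> E \<and> (length w \<ge> 2 \<longrightarrow> u \<noteq> w ! 1)}" for w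
  have finX: "finite (X w)" for w using fin by (auto simp: X_def)
  have hdS: "hd w \<in> S" if "w \<in> W j" for w j using that by (cases w) (auto simp: W_def)
  have X_ge: "card (X w) \<ge> d" if "w \<in> W j" for w j
  proof -
    have "card {u \<in> S. (u, hd w) \<in> E} \<le> card (insert (w ! 1) (X w))"
      by (rule card_mono) (use finX in \<open>auto simp: X_def\<close>)
    also have "\<dots> \<le> Suc (card (X w))" using finX by (simp add: card_insert_if)
    finally show ?thesis using deg[OF hdS[OF that]] by simp
  qed
  have step: "card (W (Suc j)) \<ge> (\<Sum>w\<in>W j. card (X w))" for j
  proof -
    have "(\<lambda>(w, u). u # w) ` (SIGMA w:W j. X w) \<subseteq> W (Suc j)"
    proof clarify
      fix w u assume *: "w \<in> W j" "u \<in> X w"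
      then have len: "length w = Suc j" by (simp add: W_def)
      then have hd: "hd w = w ! 0" by (cases w) auto
      have 1: "((u # w) ! i, (u # w) ! Suc i) \<in> E" if "i < Suc j" for i
        using * that hd by (cases i) (auto simp: W_def X_def)
      have 2: "(u # w) ! i \<noteq> (u # w) ! (i + 2)" if "i + 2 \<le> Suc j" for i
        using * that len by (cases i) (auto simp: W_def X_def)
      show "u # w \<in> W (Suc j)"
        using * 1 2 len unfolding W_def by (auto simp: X_def)
    qed
    then have "card ((\<lambda>(w, u). u # w) ` (SIGMA w:W j. X w)) \<le> card (W (Suc j))"
      by (rule card_mono[OF finW])
    moreover have "card ((\<lambda>(w, u). u # w) ` (SIGMA w:W j. X w)) = card (SIGMA w:W j. X w)"
      by (rule card_image) (auto simp: inj_on_def)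
    moreover have "card (SIGMA w:W j. X w) = (\<Sum>w\<in>W j. card (X w))"
      using finW finX by simp
    ultimately show ?thesis by simp
  qed
  \<comment> \<open>The root has no predecessor to avoid, so the first step has more than
    \<open>d\<close> extensions. This is the source of the strict inequality.\<close>
  have "card (W (Suc j)) > d ^ Suc j" for j
  proof (induction j)
    case 0
    have "W 0 = {[r]}" using r by (auto simp: W_def length_Suc_conv)
    moreover have "X [r] = {u \<in> S. (u, r) \<in> E}" by (simp add: X_def)
    ultimately show ?case using step[of 0] deg[OF r] by simp
  next
    case (Suc j)
    have "d ^ Suc (Suc j) < d * card (W (Suc j))" using Suc d by simp
    also have "\<dots> = (\<Sum>w\<in>W (Suc j). d)" by simp
    also have "\<dots> \<le> (\<Sum>w\<in>W (Suc j). card (X w))" using X_ge by (intro sum_mono) blast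
    also have "\<dots> \<le> card (W (Suc (Suc j)))" by (rule step)
    finally show ?case .
  qed
  then have "card (W k) > d ^ k" using k by (cases k) auto
  then have "card (hd ` W k) < card (W k)"
    using card_mono[OF fin, of "hd ` W k"] hdS[of _ k] card by (simp add: image_subset_iff)
  then have "\<not> inj_on hd (W k)" using card_image[of hd "W k"] by auto
  then obtain v w where vw: "v \<in> W k" "w \<in> W k" "hd v = hd w" "v \<noteq> w"
    by (auto simp: inj_on_def)
  obtain vs where "is_cycle E vs" "length vs \<le> 2 * k"
    by (rule distinct_nonbacktracking_walks_imp_cycle[OF irr sym vw(4), of k])
      (use vw in \<open>auto simp: W_def\<close>)
  then show thesis by (rule that)
qed

text \<open>Removing a vertex of degree at most \<open>d\<close> destroys at most
  \<open>2 * d\<close> arcs, counted in both directions, so the density condition survives. It fails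
  for the empty set, hence the removals stop before that.\<close>

lemma ex_min_degree_subset:
  fixes E :: "'a rel"
  assumes "finite V" "sym E" "2 * d * card V < card (E \<inter> V \<times> V)"
  shows "\<exists>S\<subseteq>V. S \<noteq> {} \<and> (\<forall>v\<in>S. d < card {u \<in> S. (u, v) \<in> E})"
  using assms(1,3)
proof (induction V rule: finite_psubset_induct)
  case (psubset V)
  show ?case
  proof (cases "\<forall>v\<in>V. d < card {u \<in> V. (u, v) \<in> E}")
    case True
    moreover have "V \<noteq> {}" using psubset.prems by auto
    ultimately show ?thesis by blast
  next
    case False
    then obtain v where v: "v \<in> V" "card {u \<in> V. (u, v) \<in> E} \<le> d" by (auto simp: not_less)
    let ?D = "{u \<in> V. (u, v) \<in> E}" and ?W = "V - {v}"
    have finV: "finite V" by fact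
    have "E \<inter> V \<times> V \<subseteq> (E \<inter> ?W \<times> ?W) \<union> ((\<lambda>u. (u, v)) ` ?D \<union> (\<lambda>u. (v, u)) ` ?D)"
      using assms(2) by (auto simp: sym_def)
    then have "card (E \<inter> V \<times> V) \<le> card ((E \<inter> ?W \<times> ?W) \<union> ((\<lambda>u. (u, v)) ` ?D \<union> (\<lambda>u. (v, u)) ` ?D))"
      by (rule card_mono[rotated]) (use finV in auto)
    also have "\<dots> \<le> card (E \<inter> ?W \<times> ?W) + (card ((\<lambda>u. (u, v)) ` ?D) + card ((\<lambda>u. (v, u)) ` ?D))"
      by (meson card_Un_le add_left_mono le_trans)
    also have "\<dots> \<le> card (E \<inter> ?W \<times> ?W) + (card ?D + card ?D)"
      using finV by (intro add_mono card_image_le) auto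
    finally have "card (E \<inter> V \<times> V) \<le> card (E \<inter> ?W \<times> ?W) + 2 * d" using v by simp
    moreover have "card V = Suc (card ?W)" using finV v by (metis card_Suc_Diff1)
    ultimately have "2 * d * card ?W < card (E \<inter> ?W \<times> ?W)" using psubset.prems by simp
    from psubset.IH[OF _ this] v(1)
    have "\<exists>S\<subseteq>?W. S \<noteq> {} \<and> (\<forall>v\<in>S. d < card {u \<in> S. (u, v) \<in> E})" by auto
    then show ?thesis by (meson Diff_subset subset_trans)
  qed
qed

lemma rel_girth_le_if_many_edges:
  fixes E :: "'a rel"
  assumes irr: "irrefl E" and sym: "sym E" and fin: "finite V" and E: "E \<subseteq> V \<times> V"
    and many: "2 * d * card V < card E" and d: "d \<ge> 1" and k: "k \<ge> 1" and card: "card V \<le> d ^ k"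
  shows "rel_girth E \<le> enat (2 * k)"
proof -
  have "E \<inter> V \<times> V = E" using E by blast
  then obtain S where S: "S \<subseteq> V" "S \<noteq> {}" "\<And>v. v \<in> S \<Longrightarrow> d < card {u \<in> S. (u, v) \<in> E}"
    using ex_min_degree_subset[OF fin sym, of d] many by auto
  have "card S \<le> d ^ k" using card card_mono[OF fin S(1)] by linarith
  with min_degree_imp_short_cycle[OF irr sym finite_subset[OF S(1) fin] S(2,3) d k]
  obtain vs where "is_cycle E vs" and le: "length vs \<le> 2 * k" by metis
  then have "rel_girth E \<le> enat (length vs)" by (intro rel_girth_le)
  also have "\<dots> \<le> enat (2 * k)" using le by simp
  finally show ?thesis .
qed

text \<open>Inclusion-exclusion cut off after the pairs: the sum exceeds the union by at most the
  number of pairs in \<open>I\<close>. Doubling and moving \<open>card I\<close> to the left avoid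
  division and subtraction.\<close>

lemma sum_card_le_if_almost_disjoint:
  fixes N :: "'a \<Rightarrow> 'b set"
  assumes "finite I" "\<And>v. v \<in> I \<Longrightarrow> finite (N v)"
    and "\<And>v w. v \<in> I \<Longrightarrow> w \<in> I \<Longrightarrow> v \<noteq> w \<Longrightarrow> card (N v \<inter> N w) \<le> 1"
  shows "2 * (\<Sum>v\<in>I. card (N v)) + card I \<le> 2 * card (\<Union>v\<in>I. N v) + card I ^ 2"
  using assms
proof (induction rule: finite_induct)
  case (insert v I)
  let ?U = "\<Union>v\<in>I. N v"
  have IH: "2 * (\<Sum>v\<in>I. card (N v)) + card I \<le> 2 * card ?U + card I ^ 2"
  proof (rule insert.IH)
    show "finite (N x)" if "x \<in> I" for x by (rule insert.prems(1)) (use that in simp)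
    show "card (N x \<inter> N y) \<le> 1" if "x \<in> I" "y \<in> I" "x \<noteq> y" for x y
      by (rule insert.prems(2)) (use that in simp_all)
  qed
  have "card (N v \<inter> ?U) = card (\<Union>w\<in>I. N v \<inter> N w)" by (simp only: Int_UN_distrib)
  also have "\<dots> \<le> (\<Sum>w\<in>I. card (N v \<inter> N w))" using insert.hyps by (intro card_UN_le)
  also have "\<dots> \<le> (\<Sum>w\<in>I. 1)" using insert.hyps(2)
    by (intro sum_mono insert.prems(2)[of v]) auto
  finally have "card (N v \<inter> ?U) \<le> card I" by simp
  moreover have "card (N v) + card ?U = card (N v \<union> ?U) + card (N v \<inter> ?U)"
    using insert.hyps insert.prems(1) by (intro card_Un_Int) auto
  ultimately show ?case using IH insert.hyps by (simp add: power2_eq_square)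
qed simp

text \<open>Two vertices with two common neighbours lie on a 4-cycle. Without one, neighbourhoods
  meet in at most one vertex, so there are fewer than \<open>q\<close> vertices of high degree, and
  their neighbourhoods are nearly disjoint subsets of \<open>{..<n}\<close>.\<close>

lemma sum_high_degrees_le:
  fixes E :: "nat rel"
  assumes irr: "irrefl E" and sym: "sym E" and E: "E \<subseteq> {..<n} \<times> {..<n}"
    and q: "n \<le> q ^ 2" "(q - 1) ^ 2 \<le> n" and no4: "\<not> rel_girth E \<le> 4"
  defines "H \<equiv> {v. v < n \<and> 2 * q < card (E `` {v})}"
  shows "(\<Sum>v\<in>H. card (E `` {v})) \<le> 2 * n"
proof -
  have fin: "finite (E `` {v})" for v
    using E by (intro finite_subset[of "E `` {v}" "{..<n}"]) auto
  have disj: "card (E `` {v} \<inter> E `` {w}) \<le> 1" if "v \<noteq> w" for v w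
  proof (rule ccontr)
    assume "\<not> ?thesis"
    then obtain x y where "x \<in> E `` {v} \<inter> E `` {w}" "y \<in> E `` {v} \<inter> E `` {w}" and ne: "x \<noteq> y"
      using card_le_Suc0_iff_eq[of "E `` {v} \<inter> E `` {w}", OF finite_Int] fin[of v] by auto
    then have xy: "(v, x) \<in> E" "(w, x) \<in> E" "(v, y) \<in> E" "(w, y) \<in> E" by simp_all
    then have "v \<noteq> x" "v \<noteq> y" "w \<noteq> x" "w \<noteq> y" using irreflD[OF irr] by metis+
    then have "distinct [v, x, w, y]" using that ne by simp
    moreover have "\<forall>i<4. ([v, x, w, y] ! i, [v, x, w, y] ! (Suc i mod 4)) \<in> E"
    proof (intro allI impI)
      fix i :: nat assume "i < 4"
      then consider "i = 0" | "i = 1" | "i = 2" | "i = 3" by linarith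
      then show "([v, x, w, y] ! i, [v, x, w, y] ! (Suc i mod 4)) \<in> E"
        using xy symD[OF sym xy(2)] symD[OF sym xy(3)] by cases simp_all
    qed
    ultimately have "is_cycle E [v, x, w, y]" by (simp add: is_cycle_def)
    then have "rel_girth E \<le> enat (length [v, x, w, y])" by (rule rel_girth_le)
    then show False using no4 by (simp add: numeral_eq_enat eval_nat_numeral)
  qed
  have bound: "2 * (\<Sum>v\<in>I. card (E `` {v})) + card I \<le> 2 * n + card I ^ 2" if "I \<subseteq> H" for I
  proof -
    have "finite I" using that by (rule finite_subset) (simp add: H_def)
    then have "2 * (\<Sum>v\<in>I. card (E `` {v})) + card I \<le> 2 * card (\<Union>v\<in>I. E `` {v}) + card I ^ 2"
      by (rule sum_card_le_if_almost_disjoint[OF _ fin disj])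
    moreover have "card (\<Union>v\<in>I. E `` {v}) \<le> card {..<n}" using E by (intro card_mono) auto
    ultimately show ?thesis by simp
  qed
  \<comment> \<open>The quadratic term of \<open>bound\<close> is harmless only for small sets. So
    exactly \<open>q\<close> vertices are taken from a large \<open>H\<close>: they give
    \<open>4 * q ^ 2 + q\<close> at most \<open>2 * n + q ^ 2\<close>, contradicting
    \<open>n \<le> q ^ 2\<close>.\<close>
  have "card H < q \<or> n = 0"
  proof (rule ccontr)
    assume *: "\<not> ?thesis"
    then obtain I where I: "I \<subseteq> H" "card I = q" by (meson not_less obtain_subset_with_card_n)
    have "q > 0" using * q by (cases q) auto
    have "(\<Sum>v\<in>I. 2 * q) \<le> (\<Sum>v\<in>I. card (E `` {v}))"
      using I by (intro sum_mono) (auto simp: H_def)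
    then have "4 * q ^ 2 + q \<le> 2 * n + q ^ 2"
      using bound[OF I(1)] I(2) by (simp add: power2_eq_square)
    then show False using q \<open>q > 0\<close> by simp
  qed
  then show ?thesis
  proof
    assume "card H < q"
    then have "card H ^ 2 \<le> (q - 1) ^ 2" by (intro power_mono) auto
    then show ?thesis using bound[OF subset_refl] q(2) by linarith
  next
    assume "n = 0"
    then show ?thesis by (simp add: H_def)
  qed
qed

section \<open>Prefix sums, ranks and residues\<close>

lemma prefix_sum_mono:
  fixes w :: "nat \<Rightarrow> nat"
  assumes "u \<le> v" shows "sum w {..<u} \<le> sum w {..<v}"
  using assms by (intro sum_mono2) auto

text \<open>List the \<open>w v\<close> items of every \<open>v\<close> in the order of the
  vertices: \<open>sum w {..<v} + x\<close> is the position of item \<open>x\<close> of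
  \<open>v\<close>, and distinct vertices occupy disjoint intervals.\<close>

lemma inj_on_position:
  fixes w :: "nat \<Rightarrow> nat"
  shows "inj_on (\<lambda>(v, x). sum w {..<v} + x) {(v, x). x < w v}"
proof -
  have less: "sum w {..<u} + x < sum w {..<v} + y" if "u < v" "x < w u" for u v x y
  proof -
    have "sum w {..<u} + x < sum w {..<Suc u}" using that by simp
    also have "\<dots> \<le> sum w {..<v}" using that by (intro prefix_sum_mono) simp
    finally show ?thesis by simp
  qed
  show ?thesis
  proof (rule inj_onI, clarify)
    fix u x v y assume *: "sum w {..<u} + x = sum w {..<v} + y" "x < w u" "y < w v"
    then have "u = v" using less[of u v x y] less[of v u y x] by (metis less_irrefl linorder_neqE_nat)
    then show "u = v \<and> x = y" using * by simp
  qed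
qed

text \<open>Within a residue class a number is determined by its quotient, and the quotients of an
  interval of length \<open>L\<close> fill at most \<open>L div r + 2\<close> consecutive
  values.\<close>

lemma card_residue_class_le:
  fixes a L r z :: nat
  assumes "r \<ge> 1"
  shows "card {p. a \<le> p \<and> p < a + L \<and> p mod r = z} \<le> L div r + 2"
proof -
  let ?X = "{p. a \<le> p \<and> p < a + L \<and> p mod r = z}"
  have inj: "inj_on (\<lambda>p. p div r) ?X"
    by (rule inj_onI) (metis (mono_tags, lifting) div_mult_mod_eq mem_Collect_eq)
  have "(\<lambda>p. p div r) ` ?X \<subseteq> {a div r .. a div r + L div r + 1}"
  proof clarsimp
    fix p assume "a \<le> p" "p < a + L"
    then have "p div r \<le> (a + L) div r" by (intro div_le_mono) simp
    also have "\<dots> \<le> a div r + L div r + 1"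
    proof -
      have "a + L < (a div r + 1) * r + (L div r + 1) * r"
        using assms by (intro add_strict_mono) (simp_all add: dividend_less_div_times)
      then have "(a + L) div r < a div r + L div r + 2"
        using assms by (simp add: div_less_iff_less_mult algebra_simps)
      then show ?thesis by simp
    qed
    finally show "a div r \<le> p div r \<and> p div r \<le> Suc (a div r + L div r)"
      using \<open>a \<le> p\<close> by (simp add: div_le_mono)
  qed
  then have "card ((\<lambda>p. p div r) ` ?X) \<le> card {a div r .. a div r + L div r + 1}"
    by (intro card_mono) auto
  then show ?thesis using card_image[OF inj] by simp
qed

text \<open>Group \<open>j\<close> consists of the vertices whose first position lies in the
  \<open>j\<close>-th interval of length \<open>B\<close>. Only its last items can stick out of that
  interval, by at most \<open>W\<close>, so all its items lie in one interval of length
  \<open>B + W\<close>.\<close>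

lemma card_group_residue_class_le:
  fixes w :: "nat \<Rightarrow> nat"
  assumes B: "B \<ge> 1" and r: "r \<ge> 1" and W: "\<And>v. v < n \<Longrightarrow> w v \<le> W" and J: "finite J"
  shows "card {(v, x). v < n \<and> x < w v \<and> sum w {..<v} div B \<in> J \<and> (sum w {..<v} + x) mod r = z}
    \<le> card J * ((B + W) div r + 2)"
proof -
  let ?A = "\<lambda>j. {(v, x). v < n \<and> x < w v \<and> sum w {..<v} div B = j \<and> (sum w {..<v} + x) mod r = z}"
  have one: "card (?A j) \<le> (B + W) div r + 2" for j
  proof -
    let ?P = "{p. j * B \<le> p \<and> p < j * B + (B + W) \<and> p mod r = z}"
    have inj: "inj_on (\<lambda>(v, x). sum w {..<v} + x) (?A j)"
      by (rule inj_on_subset[OF inj_on_position]) auto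
    have sub: "(\<lambda>(v, x). sum w {..<v} + x) ` ?A j \<subseteq> ?P"
    proof clarsimp
      fix v x assume *: "v < n" "x < w v"
      have "sum w {..<v} div B * B \<le> sum w {..<v}" by simp
      moreover have "sum w {..<v} < sum w {..<v} div B * B + B"
        using B dividend_less_div_times[of B "sum w {..<v}"] by linarith
      moreover have "x < W" using * W[of v] by simp
      ultimately show "sum w {..<v} div B * B \<le> sum w {..<v} + x \<and>
          sum w {..<v} + x < sum w {..<v} div B * B + (B + W)" by linarith
    qed
    have "card (?A j) \<le> card ?P"
      by (rule card_inj_on_le[OF inj sub]) simp
    also have "\<dots> \<le> (B + W) div r + 2" by (rule card_residue_class_le[OF r])
    finally show ?thesis .
  qed
  have eq: "{(v, x). v < n \<and> x < w v \<and> sum w {..<v} div B \<in> J \<and> (sum w {..<v} + x) mod r = z} = (\<Union>j\<in>J. ?A j)"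
    by auto
  have "card (\<Union>j\<in>J. ?A j) \<le> (\<Sum>j\<in>J. card (?A j))" by (rule card_UN_le[OF J])
  moreover have "(\<Sum>j\<in>J. card (?A j)) \<le> (\<Sum>j\<in>J. (B + W) div r + 2)"
    using one by (rule sum_mono)
  moreover have "(\<Sum>j\<in>J. (B + W) div r + 2) = card J * ((B + W) div r + 2)"
    by (simp only: sum_constant of_nat_id)
  ultimately show ?thesis unfolding eq by linarith
qed

lemma sum_group_weights_le:
  fixes w :: "nat \<Rightarrow> nat"
  assumes B: "B \<ge> 1" and W: "\<And>v. v < n \<Longrightarrow> w v \<le> W" and J: "finite J"
  shows "(\<Sum>v | v < n \<and> sum w {..<v} div B \<in> J. w v) \<le> card J * (B + W + 2)"
proof -
  \<comment> \<open>Modulo \<open>1\<close> every item is in class \<open>0\<close>, so the residue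
    bound becomes a bound on the total weight.\<close>
  have "{(v, x). v < n \<and> x < w v \<and> sum w {..<v} div B \<in> J \<and> (sum w {..<v} + x) mod 1 = 0}
      = (SIGMA v:{v. v < n \<and> sum w {..<v} div B \<in> J}. {..<w v})" by auto
  then have "card {(v, x). v < n \<and> x < w v \<and> sum w {..<v} div B \<in> J \<and> (sum w {..<v} + x) mod 1 = 0}
      = (\<Sum>v | v < n \<and> sum w {..<v} div B \<in> J. w v)" by simp
  moreover have "card {(v, x). v < n \<and> x < w v \<and> sum w {..<v} div B \<in> J \<and> (sum w {..<v} + x) mod 1 = 0}
      \<le> card J * ((B + W) div 1 + 2)"
    using W by (intro card_group_residue_class_le[OF B _ _ J]) simp_all
  ultimately show ?thesis by simp
qed

text \<open>Turns the neighbour \<open>y\<close> into a slot number, so that arcs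
  \<open>(v, y)\<close> become items \<open>(v, x)\<close> with a position.\<close>

definition rank :: "nat set \<Rightarrow> nat \<Rightarrow> nat" where
  "rank X y = card {x \<in> X. x < y}"

lemma rank_less: "finite X \<Longrightarrow> y \<in> X \<Longrightarrow> rank X y < card X"
  unfolding rank_def by (intro psubset_card_mono) auto

lemma inj_on_rank:
  assumes "finite X" shows "inj_on (rank X) X"
proof (rule linorder_inj_onI)
  fix x y assume "x < y" "x \<in> X" "y \<in> X"
  then have "rank X x < rank X y"
    unfolding rank_def using assms by (intro psubset_card_mono) auto
  then show "rank X x \<noteq> rank X y" by simp
qed auto

text \<open>Dealing in turn, from any starting offset \<open>a\<close>, bounds what one vertex sends
  over one link.\<close>

lemma card_dealt_le:
  assumes "finite X" "r \<ge> 1"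
  shows "card {y \<in> X. (a + rank X y) mod r = z} \<le> card X div r + 2"
proof -
  have "card {y \<in> X. (a + rank X y) mod r = z} \<le> card {p. a \<le> p \<and> p < a + card X \<and> p mod r = z}"
  proof (rule card_inj_on_le)
    show "inj_on (\<lambda>y. a + rank X y) {y \<in> X. (a + rank X y) mod r = z}"
      using inj_on_rank[OF assms(1)] by (auto simp: inj_on_def)
    show "(\<lambda>y. a + rank X y) ` {y \<in> X. (a + rank X y) mod r = z} \<subseteq>
        {p. a \<le> p \<and> p < a + card X \<and> p mod r = z}"
      using rank_less[OF assms(1)] by auto
  qed simp
  also have "\<dots> \<le> card X div r + 2" by (rule card_residue_class_le[OF assms(2)])
  finally show ?thesis .
qed

lemma card_arcs_by_rank_le:
  fixes w :: "nat \<Rightarrow> nat"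
  assumes "\<And>v. v < n \<Longrightarrow> finite (X v)" "\<And>v. v < n \<Longrightarrow> w v = card (X v)"
  shows "card {(v, y). v < n \<and> y \<in> X v \<and> Q v (rank (X v) y)} \<le> card {(v, x). v < n \<and> x < w v \<and> Q v x}"
proof (rule card_inj_on_le)
  let ?f = "\<lambda>(v, y). (v, rank (X v) y)"
  show "inj_on ?f {(v, y). v < n \<and> y \<in> X v \<and> Q v (rank (X v) y)}"
    using inj_on_rank[OF assms(1)] by (auto simp: inj_on_def)
  show "?f ` {(v, y). v < n \<and> y \<in> X v \<and> Q v (rank (X v) y)} \<subseteq> {(v, x). v < n \<and> x < w v \<and> Q v x}"
    using rank_less[OF assms(1)] assms(2) by auto
  have "{(v, x). v < n \<and> x < w v \<and> Q v x} \<subseteq> (SIGMA v:{..<n}. {..<w v})" by auto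
  then show "finite {(v, x). v < n \<and> x < w v \<and> Q v x}" by (rule finite_subset) simp
qed

text \<open>An arbitrary numbering is enough: only the processor that holds the set uses it, to
  spread the elements over intermediate processors.\<close>

definition index_in :: "'a set \<Rightarrow> 'a \<Rightarrow> nat" where
  "index_in X = (SOME f. bij_betw f X {0..<card X})"

lemma bij_betw_index_in: "finite X \<Longrightarrow> bij_betw (index_in X) X {0..<card X}"
  unfolding index_in_def using ex_bij_betw_finite_nat by (rule someI_ex)

lemma card_index_class_le:
  assumes fin: "finite X" and card: "card X \<le> K * t"
  shows "card {a \<in> X. index_in X a mod t = c} \<le> K"
proof (cases "X = {}")
  case False
  let ?A = "{a \<in> X. index_in X a mod t = c}"
  have t: "t > 0" using False fin card by (cases t) auto
  have bij: "bij_betw (index_in X) X {0..<card X}" using fin by (rule bij_betw_index_in)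
  have "inj_on (\<lambda>a. index_in X a div t) ?A"
  proof (rule inj_onI)
    fix a b assume *: "a \<in> ?A" "b \<in> ?A" "index_in X a div t = index_in X b div t"
    then have "index_in X a = index_in X b"
      by (metis (mono_tags, lifting) div_mult_mod_eq mem_Collect_eq)
    then show "a = b" using * bij by (auto simp: bij_betw_def inj_on_def)
  qed
  moreover have "(\<lambda>a. index_in X a div t) ` ?A \<subseteq> {..<K}"
  proof clarsimp
    fix a assume "a \<in> X"
    then have "index_in X a < card X" using bij by (auto simp: bij_betw_def)
    then have "index_in X a < K * t" using card by simp
    then show "index_in X a div t < K" using t by (simp add: div_less_iff_less_mult)
  qed
  ultimately have "card ?A \<le> card {..<K}" by (rule card_inj_on_le) simp
  then show ?thesis by simp
qed simp

text \<open>The Latin square property behind the routing pattern.\<close>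

lemma mod_add_left_inj:
  fixes a b c r :: nat
  assumes "(a + b) mod r = (a + c) mod r" "b < r" "c < r"
  shows "b = c"
  using assms cong_add_lcancel_nat[of a b c r] by (simp add: cong_def)

section \<open>Communication primitives\<close>

lemma mod_less_of_mult_le: "T * r + z < t * r \<and> (T * r + z) div r = T \<and> (T * r + z) mod r = z"
  if "T < t" "z < r" for T z t r :: nat
proof -
  have "T * r + z < Suc T * r" using that by simp
  also have "\<dots> \<le> t * r" using that by (intro mult_le_mono1) simp
  finally show ?thesis using that by simp
qed

text \<open>Processor \<open>T * r + z\<close> with \<open>T < t\<close>, \<open>z < r\<close> is the \<open>z\<close>-th member of block \<open>T\<close>. The arcs
  \<open>(v, y)\<close> with \<open>y \<in> N v T\<close> are dealt evenly to block \<open>T\<close> by their position in the list sorted by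
  \<open>v\<close>; from there they are routed to the members \<open>T'\<close> of the same block that want them. The message
  with number \<open>i\<close> from member \<open>z\<close> to member \<open>T'\<close> goes through the intermediate processor
  \<open>(i mod t) * r + (z + T') mod r\<close>: this Latin square pattern loads every link evenly.\<close>

lemma cc_computable_collect:
  fixes N :: "nat \<Rightarrow> nat pair_pre_digraph \<Rightarrow> nat \<Rightarrow> nat \<Rightarrow> nat set"
    and t r :: "nat \<Rightarrow> nat pair_pre_digraph \<Rightarrow> nat"
    and Sel :: "nat \<Rightarrow> nat pair_pre_digraph \<Rightarrow> (nat \<Rightarrow> nat) \<Rightarrow> nat \<Rightarrow> nat \<Rightarrow> bool"
  assumes N: "cc_computable N" and t: "cc_computable (\<lambda>n G _. t n G)"
    and r: "cc_computable (\<lambda>n G _. r n G)" and Sel: "cc_computable (\<lambda>n G _. Sel n G)"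
  obtains f where "cc_computable f"
    "\<And>n G w T T'. cc_input n G \<Longrightarrow> n \<ge> 2 \<Longrightarrow> t n G \<le> r n G \<Longrightarrow> r n G \<ge> 1 \<Longrightarrow> t n G * r n G \<le> n \<Longrightarrow>
      (\<And>T v. w T v = (if v < n then card (N n G v T) else 0)) \<Longrightarrow>
      (\<And>v T. v < n \<Longrightarrow> T < t n G \<Longrightarrow> N n G v T \<subseteq> {..<n} \<and> card (N n G v T) \<le> K1 * r n G) \<Longrightarrow>
      (\<And>T T' z. T < t n G \<Longrightarrow> T' < t n G \<Longrightarrow> z < r n G \<Longrightarrow>
         card {(v, x). v < n \<and> x < w T v \<and> Sel n G (w T) v T' \<and>
           (sum (w T) {..<v} + x) mod r n G = z} \<le> K2 * t n G) \<Longrightarrow>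
      T < t n G \<Longrightarrow> T' < t n G \<Longrightarrow>
      f n G (T * r n G + T') = {(v, y). v < n \<and> y \<in> N n G v T \<and> Sel n G (w T) v T'}"
proof -
  define M1 where "M1 = (\<lambda>n G v p. card (N n G v (p div r n G)))"
  have M1: "cc_computable M1"
    unfolding M1_def by (rule cc_computable_local2[OF N r])
  define W where "W = (\<lambda>n G p u. if u < n \<and> M1 n G u p < n ^ 2 then M1 n G u p else 0)"
  have W: "cc_computable W" unfolding W_def by (rule cc_computable_exchange_nat[OF M1])
  \<comment> \<open>A vertex \<open>v\<close> knows only its own weight for a block, while the
    members of the block know all of them. They send \<open>v\<close> its offset; \<open>v\<close>
    uses the copy of the first member, number \<open>T * r\<close>.\<close>
  define M2 where "M2 = (\<lambda>n G p v :: nat. sum (W n G p) {..<v})"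
  have M2: "cc_computable M2" unfolding M2_def by (rule cc_computable_local[OF W])
  define S where "S = (\<lambda>n G v p. if p < n \<and> M2 n G p v < n ^ 3 then M2 n G p v else 0)"
  have S: "cc_computable S" unfolding S_def by (rule cc_computable_exchange_nat[OF M2])
  define M3 where "M3 = (\<lambda>n G v p. {y \<in> N n G v (p div r n G).
    (S n G v (p div r n G * r n G) + rank (N n G v (p div r n G)) y) mod r n G = p mod r n G})"
  have M3: "cc_computable M3" unfolding M3_def by (rule cc_computable_local3[OF N S r])
  \<comment> \<open>The cutoff is the rounded share of one member when at most \<open>K1 * r\<close>
    arcs are dealt to \<open>r\<close> members.\<close>
  define R3 where "R3 = (\<lambda>n G p v. if v < n \<and> M3 n G v p \<subseteq> {..<n} \<and> card (M3 n G v p) \<le> K1 + 2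
    then M3 n G v p else {})"
  have R3: "cc_computable R3" unfolding R3_def
    by (rule cc_computable_exchange_set[OF M3, of "\<lambda>n. {..<n}" 1]) simp
  define D where "D = (\<lambda>n G p T'. {(v, y). v < n \<and> y \<in> R3 n G p v \<and> Sel n G (W n G p) v T'})"
  have D: "cc_computable D" unfolding D_def by (rule cc_computable_local3[OF R3 W Sel])
  \<comment> \<open>The condition on \<open>I mod r\<close> is the Latin square. The one on
    \<open>I div r\<close> spreads the arcs wanted by \<open>T'\<close> over \<open>t\<close>
    classes, so at most \<open>K2 * t\<close> arcs leave at most \<open>K2\<close> for each
    intermediate.\<close>
  define M4 where "M4 = (\<lambda>n G p I. {(T', a). T' < t n G \<and> a \<in> D n G p T' \<and>
    I mod r n G = (p + T') mod r n G \<and> I div r n G = index_in (D n G p T') a mod t n G})"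
  have M4: "cc_computable M4" unfolding M4_def by (rule cc_computable_local3[OF D t r])
  define R4 where "R4 = (\<lambda>n G I p. if p < n \<and> M4 n G p I \<subseteq> {..<n} \<times> {..<n} \<times> {..<n} \<and>
    card (M4 n G p I) \<le> K2 then M4 n G p I else {})"
  have R4: "cc_computable R4" unfolding R4_def
    by (rule cc_computable_exchange_set[OF M4, of "\<lambda>n. {..<n} \<times> {..<n} \<times> {..<n}" 3])
      (simp add: power3_eq_cube)
  \<comment> \<open>A message names only the recipient's place \<open>q mod r\<close>; the
    recipient's block is that of the sender \<open>p\<close>.\<close>
  define M5 where "M5 = (\<lambda>n G I q. {a. \<exists>p<n. p div r n G = q div r n G \<and> (q mod r n G, a) \<in> R4 n G I p})"
  have M5: "cc_computable M5" unfolding M5_def by (rule cc_computable_local2[OF R4 r])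
  define R5 where "R5 = (\<lambda>n G q I. if I < n \<and> M5 n G I q \<subseteq> {..<n} \<times> {..<n} \<and>
    card (M5 n G I q) \<le> K2 then M5 n G I q else {})"
  have R5: "cc_computable R5" unfolding R5_def
    by (rule cc_computable_exchange_set[OF M5, of "\<lambda>n. {..<n} \<times> {..<n}" 2])
      (simp add: power2_eq_square)
  define f where "f = (\<lambda>n G q. \<Union>I. R5 n G q I)"
  have f: "cc_computable f" unfolding f_def by (rule cc_computable_local[OF R5])
  \<comment> \<open>Under the load assumptions no cutoff takes effect on the arcs for block
    \<open>T\<close> bound for \<open>T'\<close>.\<close>
  have correct: "f n G (T * r n G + T') = {(v, y). v < n \<and> y \<in> N n G v T \<and> Sel n G (w T) v T'}"
    if "cc_input n G" and n2: "n \<ge> 2" and "t n G \<le> r n G" "r n G \<ge> 1" and "t n G * r n G \<le> n"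
      and w_def: "\<And>T v. w T v = (if v < n then card (N n G v T) else 0)"
      and NN: "\<And>v T. v < n \<Longrightarrow> T < t n G \<Longrightarrow> N n G v T \<subseteq> {..<n} \<and> card (N n G v T) \<le> K1 * r n G"
      and cnt: "\<And>T T' z. T < t n G \<Longrightarrow> T' < t n G \<Longrightarrow> z < r n G \<Longrightarrow>
         card {(v, x). v < n \<and> x < w T v \<and> Sel n G (w T) v T' \<and>
           (sum (w T) {..<v} + x) mod r n G = z} \<le> K2 * t n G"
      and T: "T < t n G" and T': "T' < t n G" for n G w T T'
  proof -
    define tt where "tt = t n G"
    define rr where "rr = r n G"
    have tr: "tt \<le> rr" and r1: "rr \<ge> 1" and trn: "tt * rr \<le> n" using that by (simp_all add: tt_def rr_def)
    have Tt: "T < tt" and T't: "T' < tt" using T T' by (simp_all add: tt_def)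
    define X where "X v = N n G v T" for v
    have X: "X v \<subseteq> {..<n}" "card (X v) \<le> K1 * rr" "finite (X v)" if "v < n" for v
      using NN[OF that T] finite_subset[of "X v" "{..<n}"] by (auto simp: X_def rr_def)
    have wX: "w T v = card (X v)" if "v < n" for v using that by (simp add: w_def X_def)
    have wn: "w T v \<le> n" for v
      using card_mono[OF _ X(1), of v] wX[of v] by (cases "v < n") (auto simp: w_def)
    have nn: "n < n ^ 2" "n * n < n ^ 3" using n2 by (simp_all add: power2_eq_square power3_eq_cube)
    have Weq: "W n G p = w T" if p: "p div rr = T" for p
    proof
      fix v
      show "W n G p v = w T v"
        using wX[of v] wn[of v] nn p by (auto simp: W_def M1_def X_def rr_def w_def)
    qed
    have sumle: "sum (w T) {..<v} < n ^ 3" if "v < n" for v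
    proof -
      have "sum (w T) {..<v} \<le> (\<Sum>u<v. n)" using wn by (intro sum_mono) simp
      also have "\<dots> \<le> n * n" using that by simp
      finally show ?thesis using nn by simp
    qed
    have inblock: "T * rr + z < n" "(T * rr + z) div rr = T" "(T * rr + z) mod rr = z" if "z < rr" for z
      using mod_less_of_mult_le[OF Tt that] trn by auto
    have Seq: "S n G v (T * rr) = sum (w T) {..<v}" if "v < n" for v
      using inblock[of 0] r1 sumle[OF that] by (simp add: S_def M2_def Weq)
    define Y where "Y z v = {y \<in> X v. (sum (w T) {..<v} + rank (X v) y) mod rr = z}" for z v
    have M3eq: "M3 n G v (T * rr + z) = Y z v" if "v < n" "z < rr" for v z
      using inblock[OF that(2)] Seq[OF that(1)] by (simp add: M3_def Y_def X_def flip: rr_def)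
    have R3eq: "R3 n G (T * rr + z) v = Y z v" if "v < n" "z < rr" for v z
    proof -
      have "card (Y z v) \<le> card (X v) div rr + 2"
        unfolding Y_def by (rule card_dealt_le[OF X(3)[OF that(1)] r1])
      also have "\<dots> \<le> K1 + 2" using div_le_mono[OF X(2)[OF that(1)], of rr] r1 by simp
      finally have "card (Y z v) \<le> K1 + 2" .
      moreover have "Y z v \<subseteq> {..<n}" using X(1)[OF that(1)] by (auto simp: Y_def)
      ultimately show ?thesis using that by (simp add: R3_def M3eq)
    qed
    define Z where "Z z T' = {(v, y). v < n \<and> y \<in> Y z v \<and> Sel n G (w T) v T'}" for z T'
    have Deq: "D n G (T * rr + z) U = Z z U" if "z < rr" for z U
      using that by (auto simp: D_def Z_def R3eq Weq inblock)
    have Zsub: "Z z U \<subseteq> {..<n} \<times> {..<n}" for z U using X(1) by (fastforce simp: Z_def Y_def)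
    have finZ: "finite (Z z U)" for z U by (rule finite_subset[OF Zsub]) simp
    have cardZ: "card (Z z U) \<le> K2 * tt" if "z < rr" "U < tt" for z U
    proof -
      have eq: "Z z U = {(v, y). v < n \<and> y \<in> X v \<and> (Sel n G (w T) v U \<and>
          (sum (w T) {..<v} + rank (X v) y) mod rr = z)}" by (auto simp: Z_def Y_def)
      have "card (Z z U) \<le> card {(v, x). v < n \<and> x < w T v \<and> (Sel n G (w T) v U \<and>
          (sum (w T) {..<v} + x) mod rr = z)}"
        unfolding eq by (rule card_arcs_by_rank_le[where Q = "\<lambda>v x. Sel n G (w T) v U \<and>
          (sum (w T) {..<v} + x) mod rr = z"]) (simp_all add: X wX)
      then show ?thesis using cnt[OF T, of U z] that by (simp add: tt_def rr_def)
    qed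
    define C where "C z U c = {a \<in> Z z U. index_in (Z z U) a mod tt = c}" for z U c
    have cardC: "card (C z U c) \<le> K2" if "z < rr" "U < tt" for z U c
      unfolding C_def by (rule card_index_class_le[OF finZ cardZ[OF that]])
    have finC: "finite (C z U c)" for z U c using finZ by (auto simp: C_def)
    have M4eq: "M4 n G (T * rr + z) I =
        {(U, a). U < tt \<and> a \<in> C z U (I div rr) \<and> I mod rr = (T * rr + z + U) mod rr}" if "z < rr" for z I
      by (auto simp: M4_def C_def Deq[OF that] simp flip: rr_def tt_def)
    have R4eq: "R4 n G I (T * rr + z) = M4 n G (T * rr + z) I" if z: "z < rr" for z I
    proof -
      \<comment> \<open>For a fixed sender and intermediate, \<open>I mod rr\<close> determines the
        recipient \<open>U\<close>, because \<open>U < tt\<close> and \<open>tt \<le> rr\<close>. So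
        the link carries a single class \<open>C z U c\<close>.\<close>
      have "card (M4 n G (T * rr + z) I) \<le> K2"
      proof (cases "M4 n G (T * rr + z) I = {}")
        case False
        then obtain U a where U: "U < tt" "I mod rr = (T * rr + z + U) mod rr" by (auto simp: M4eq[OF z])
        have "M4 n G (T * rr + z) I \<subseteq> Pair U ` C z U (I div rr)"
        proof
          fix x assume "x \<in> M4 n G (T * rr + z) I"
          then obtain U' b where x: "x = (U', b)" "U' < tt" "b \<in> C z U' (I div rr)"
            "I mod rr = (T * rr + z + U') mod rr" by (auto simp: M4eq[OF z])
          then have "U' = U" using U tr by (intro mod_add_left_inj[of "T * rr + z" U' rr U]) auto
          then show "x \<in> Pair U ` C z U (I div rr)" using x by auto
        qed
        then have "card (M4 n G (T * rr + z) I) \<le> card (Pair U ` C z U (I div rr))"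
          by (rule card_mono[rotated]) (simp add: finC)
        also have "\<dots> \<le> card (C z U (I div rr))" by (rule card_image_le[OF finC])
        also have "\<dots> \<le> K2" by (rule cardC[OF z U(1)])
        finally show ?thesis .
      qed simp
      moreover have "M4 n G (T * rr + z) I \<subseteq> {..<n} \<times> {..<n} \<times> {..<n}"
      proof -
        have "tt \<le> n" using trn r1 by (metis le_trans mult_le_mono2 nat_mult_1_right)
        then show ?thesis using Zsub[of z] by (fastforce simp: M4eq[OF z] C_def)
      qed
      ultimately show ?thesis using inblock[OF z] by (simp add: R4_def)
    qed
    have q: "(T * rr + T') div rr = T" "(T * rr + T') mod rr = T'" "T' mod rr = T'"
      using inblock[of T'] T't tr by auto
    have M5eq: "M5 n G I (T * rr + T') =
        {a. \<exists>z<rr. a \<in> C z T' (I div rr) \<and> I mod rr = (T * rr + z + T') mod rr}" (is "_ = ?R") for I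
    proof (intro equalityI subsetI)
      fix a assume "a \<in> M5 n G I (T * rr + T')"
      then have "\<exists>p<n. p div rr = T \<and> (T', a) \<in> R4 n G I p"
        by (simp add: M5_def q flip: rr_def)
      then obtain p where p: "p < n" "p div rr = T" "(T', a) \<in> R4 n G I p" by blast
      then have "p = T * rr + p mod rr" "p mod rr < rr" using r1 div_mult_mod_eq[of p rr] by auto
      then show "a \<in> ?R" using p(3) R4eq[of "p mod rr" I] M4eq[of "p mod rr" I] by auto
    next
      fix a assume "a \<in> ?R"
      then obtain z where z: "z < rr" "a \<in> C z T' (I div rr)" "I mod rr = (T * rr + z + T') mod rr" by auto
      then have "(T', a) \<in> R4 n G I (T * rr + z)" using T't by (simp add: R4eq M4eq)
      then show "a \<in> M5 n G I (T * rr + T')"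
        using inblock[OF z(1)] by (auto simp: M5_def q simp flip: rr_def)
    qed
    have R5eq: "R5 n G (T * rr + T') I = M5 n G I (T * rr + T')" if "I < n" for I
    proof -
      \<comment> \<open>Symmetrically, the intermediate and the recipient determine the sender
        \<open>z\<close>.\<close>
      have "card (M5 n G I (T * rr + T')) \<le> K2"
      proof (cases "M5 n G I (T * rr + T') = {}")
        case False
        then obtain z where z: "z < rr" "I mod rr = (T * rr + z + T') mod rr" by (auto simp: M5eq)
        have "M5 n G I (T * rr + T') \<subseteq> C z T' (I div rr)"
        proof
          fix a assume "a \<in> M5 n G I (T * rr + T')"
          then obtain z' where z': "z' < rr" "a \<in> C z' T' (I div rr)" "I mod rr = (T * rr + z' + T') mod rr"
            by (auto simp: M5eq)
          have "(T * rr + T' + z') mod rr = (T * rr + T' + z) mod rr"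
            using z(2) z'(3) by (simp add: add_ac)
          then have "z' = z" using z'(1) z(1) by (rule mod_add_left_inj)
          then show "a \<in> C z T' (I div rr)" using z' by simp
        qed
        then have "card (M5 n G I (T * rr + T')) \<le> card (C z T' (I div rr))"
          by (rule card_mono[OF finC])
        also have "\<dots> \<le> K2" by (rule cardC[OF z(1) T't])
        finally show ?thesis .
      qed simp
      moreover have "M5 n G I (T * rr + T') \<subseteq> {..<n} \<times> {..<n}"
        using Zsub by (fastforce simp: M5eq C_def)
      ultimately show ?thesis using that by (simp add: R5_def)
    qed
    have R5none: "R5 n G q I = {}" if "\<not> I < n" for q I using that by (simp add: R5_def)
    have "f n G (T * rr + T') = {(v, y). v < n \<and> y \<in> X v \<and> Sel n G (w T) v T'}"
    proof (intro equalityI subsetI)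
      fix a assume "a \<in> f n G (T * rr + T')"
      then obtain I where "a \<in> R5 n G (T * rr + T') I" by (auto simp: f_def)
      then have "a \<in> M5 n G I (T * rr + T')" using R5eq[of I] R5none[of I] by (cases "I < n") auto
      then show "a \<in> {(v, y). v < n \<and> y \<in> X v \<and> Sel n G (w T) v T'}"
        by (auto simp: M5eq C_def Z_def Y_def)
    next
      fix a assume "a \<in> {(v, y). v < n \<and> y \<in> X v \<and> Sel n G (w T) v T'}"
      then obtain v y where a: "a = (v, y)" "v < n" "y \<in> X v" "Sel n G (w T) v T'" by auto
      define z where "z = (sum (w T) {..<v} + rank (X v) y) mod rr"
      have z: "z < rr" using r1 by (simp add: z_def)
      have aZ: "a \<in> Z z T'" using a by (simp add: Z_def Y_def z_def)
      define c where "c = index_in (Z z T') a mod tt"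
      have c: "c < tt" using T't by (simp add: c_def)
      have aC: "a \<in> C z T' c" using aZ by (simp add: C_def c_def)
      define I where "I = c * rr + (T * rr + z + T') mod rr"
      have m: "(T * rr + z + T') mod rr < rr" using r1 by simp
      have I: "I < n" "I div rr = c" "I mod rr = (T * rr + z + T') mod rr"
        using mod_less_of_mult_le[OF c m] trn by (simp_all add: I_def)
      then have "a \<in> M5 n G I (T * rr + T')" using aC z by (auto simp: M5eq)
      then have "a \<in> R5 n G (T * rr + T') I" using R5eq[OF I(1)] by simp
      then show "a \<in> f n G (T * rr + T')" by (auto simp: f_def)
    qed
    then show ?thesis by (simp add: X_def rr_def)
  qed
  show thesis
  proof (rule that[OF f], goal_cases)
    case 1
    show ?case by (rule correct) (fact 1)+
  qed
qed

text \<open>Deal the arcs to all \<open>n\<close> processors in turn; each then holds at most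
  \<open>K + 2\<close> of them and sends its whole share to everyone. Weights go to all processors,
  so every vertex computes its own offset.\<close>

lemma cc_computable_public_arcs:
  fixes A :: "nat \<Rightarrow> nat pair_pre_digraph \<Rightarrow> nat \<Rightarrow> nat set"
  assumes A: "cc_computable A"
  obtains f where "cc_computable f"
    "\<And>n G p. cc_input n G \<Longrightarrow> n \<ge> 2 \<Longrightarrow> p < n \<Longrightarrow> (\<And>v. v < n \<Longrightarrow> A n G v \<subseteq> {..<n}) \<Longrightarrow>
       (\<Sum>v<n. card (A n G v)) \<le> K * n \<Longrightarrow>
       f n G p = {(v, y). v < n \<and> y \<in> A n G v}"
proof -
  define M1 where "M1 = (\<lambda>n G v (p::nat). card (A n G v))"
  have M1: "cc_computable M1" unfolding M1_def by (rule cc_computable_local[OF A])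
  define W where "W = (\<lambda>n G p u. if u < n \<and> M1 n G u p < n ^ 2 then M1 n G u p else 0)"
  have W: "cc_computable W" unfolding W_def by (rule cc_computable_exchange_nat[OF M1])
  define M2 where "M2 = (\<lambda>n G v p. {y \<in> A n G v. (sum (W n G v) {..<v} + rank (A n G v) y) mod n = p})"
  have M2: "cc_computable M2" unfolding M2_def by (rule cc_computable_local2[OF A W])
  \<comment> \<open>A vertex has at most \<open>n\<close> arcs for \<open>n\<close> recipients:
    \<open>n div n + 2 = 3\<close>.\<close>
  define R2 where "R2 = (\<lambda>n G p v. if v < n \<and> M2 n G v p \<subseteq> {..<n} \<and> card (M2 n G v p) \<le> 3
    then M2 n G v p else {})"
  have R2: "cc_computable R2" unfolding R2_def
    by (rule cc_computable_exchange_set[OF M2, of "\<lambda>n. {..<n}" 1]) simp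
  define M3 where "M3 = (\<lambda>n G p (q::nat). {(v, y). v < n \<and> y \<in> R2 n G p v})"
  have M3: "cc_computable M3" unfolding M3_def by (rule cc_computable_local[OF R2])
  define R3 where "R3 = (\<lambda>n G q p. if p < n \<and> M3 n G p q \<subseteq> {..<n} \<times> {..<n} \<and> card (M3 n G p q) \<le> K + 2
    then M3 n G p q else {})"
  have R3: "cc_computable R3" unfolding R3_def
    by (rule cc_computable_exchange_set[OF M3, of "\<lambda>n. {..<n} \<times> {..<n}" 2]) (simp add: power2_eq_square)
  define f where "f = (\<lambda>n G q. \<Union>p. R3 n G q p)"
  have f: "cc_computable f" unfolding f_def by (rule cc_computable_local[OF R3])
  have correct: "f n G q = {(v, y). v < n \<and> y \<in> A n G v}"
    if "cc_input n G" and n2: "n \<ge> 2" and q: "q < n" and sub: "\<And>v. v < n \<Longrightarrow> A n G v \<subseteq> {..<n}"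
      and total: "(\<Sum>v<n. card (A n G v)) \<le> K * n" for n G q
  proof -
    define X where "X v = A n G v" for v
    define w where "w v = (if v < n then card (X v) else 0)" for v
    have finX: "finite (X v)" if "v < n" for v
      using sub[OF that] finite_subset[of "X v" "{..<n}"] by (simp add: X_def)
    have wn: "card (X v) \<le> n" if "v < n" for v
      using card_mono[OF _ sub[OF that]] by (simp add: X_def)
    have nn: "n < n ^ 2" using n2 by (simp add: power2_eq_square)
    have Weq: "W n G p = w" for p
    proof
      fix v show "W n G p v = w v" using wn[of v] nn by (auto simp: W_def M1_def w_def X_def)
    qed
    define Y where "Y p v = {y \<in> X v. (sum w {..<v} + rank (X v) y) mod n = p}" for p v
    have R2eq: "R2 n G p v = Y p v" if v: "v < n" for p v
    proof -
      have "card (Y p v) \<le> card (X v) div n + 2"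
        unfolding Y_def by (rule card_dealt_le[OF finX[OF v]]) (use n2 in simp)
      also have "\<dots> \<le> 3" using wn[OF v] n2 div_le_mono[OF wn[OF v], of n] by simp
      finally have "card (Y p v) \<le> 3" .
      moreover have "Y p v \<subseteq> {..<n}" using sub[OF v] by (auto simp: Y_def X_def)
      moreover have "M2 n G v p = Y p v" by (simp add: M2_def Y_def X_def Weq)
      ultimately show ?thesis using v by (simp add: R2_def)
    qed
    have M3eq: "M3 n G p u = {(v, y). v < n \<and> y \<in> Y p v}" for p u
      by (auto simp: M3_def R2eq)
    have R3eq: "R3 n G q p = {(v, y). v < n \<and> y \<in> Y p v}" if p: "p < n" for p
    proof -
      let ?Q = "\<lambda>v x. (sum w {..<v} + x) mod n = p"
      have eq: "{(v, y). v < n \<and> y \<in> Y p v} = {(v, y). v < n \<and> y \<in> X v \<and> ?Q v (rank (X v) y)}"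
        by (auto simp: Y_def)
      have "card {(v, y). v < n \<and> y \<in> Y p v} \<le> card {(v, x). v < n \<and> x < w v \<and> ?Q v x}"
        unfolding eq by (rule card_arcs_by_rank_le[where Q = ?Q]) (simp_all add: finX w_def)
      also have "\<dots> \<le> card {P. 0 \<le> P \<and> P < 0 + K * n \<and> P mod n = p}"
      proof (rule card_inj_on_le)
        show "inj_on (\<lambda>(v, x). sum w {..<v} + x) {(v, x). v < n \<and> x < w v \<and> ?Q v x}"
          by (rule inj_on_subset[OF inj_on_position]) auto
        show "(\<lambda>(v, x). sum w {..<v} + x) ` {(v, x). v < n \<and> x < w v \<and> ?Q v x} \<subseteq>
            {P. 0 \<le> P \<and> P < 0 + K * n \<and> P mod n = p}"
        proof clarsimp
          fix v x assume "v < n" "x < w v"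
          then have "sum w {..<v} + x < sum w {..<Suc v}" by simp
          also have "\<dots> \<le> sum w {..<n}" using \<open>v < n\<close> by (intro prefix_sum_mono) simp
          also have "\<dots> = (\<Sum>v<n. card (A n G v))" by (simp add: w_def X_def)
          finally show "sum w {..<v} + x < K * n" using total by simp
        qed
      qed simp
      also have "\<dots> \<le> K * n div n + 2" by (rule card_residue_class_le) (use n2 in simp)
      also have "\<dots> = K + 2" using n2 by simp
      finally have "card {(v, y). v < n \<and> y \<in> Y p v} \<le> K + 2" .
      moreover have "{(v, y). v < n \<and> y \<in> Y p v} \<subseteq> {..<n} \<times> {..<n}"
        using sub by (fastforce simp: Y_def X_def)
      ultimately show ?thesis using p by (simp add: R3_def M3eq)
    qed
    have R3none: "R3 n G q p = {}" if "\<not> p < n" for p using that by (simp add: R3_def)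
    show ?thesis
    proof (intro equalityI subsetI)
      fix a assume "a \<in> f n G q"
      then obtain p where "a \<in> R3 n G q p" by (auto simp: f_def)
      then have "a \<in> {(v, y). v < n \<and> y \<in> Y p v}" using R3eq[of p] R3none[of p] by (cases "p < n") auto
      then show "a \<in> {(v, y). v < n \<and> y \<in> A n G v}" by (auto simp: Y_def X_def)
    next
      fix a assume "a \<in> {(v, y). v < n \<and> y \<in> A n G v}"
      then obtain v y where a: "a = (v, y)" "v < n" "y \<in> X v" by (auto simp: X_def)
      define p where "p = (sum w {..<v} + rank (X v) y) mod n"
      have "p < n" using n2 by (simp add: p_def)
      then have "a \<in> R3 n G q p" using a by (simp add: R3eq Y_def p_def)
      then show "a \<in> f n G q" by (auto simp: f_def)
    qed
  qed
  show thesis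
  proof (rule that[OF f], goal_cases)
    case 1
    show ?case by (rule correct) (fact 1)+
  qed
qed

section \<open>Choice of the parameters\<close>

text \<open>The quotient of consecutive terms of \<open>k ^ k / fact k\<close> is
  \<open>(1 + 1 / k) ^ k\<close>, at most \<open>exp 1\<close> and hence at most
  \<open>3\<close>.\<close>

lemma power_self_le_fact: "k ^ k \<le> 3 ^ k * fact k" for k :: nat
proof (induction k)
  case (Suc k)
  show ?case
  proof (cases "k = 0")
    case False
    have "1 + 1 / real k \<le> exp (1 / real k)" by (rule exp_ge_add_one_self)
    then have "(1 + 1 / real k) ^ k \<le> exp (1 / real k) ^ k" by (rule power_mono) simp
    also have "\<dots> = exp 1" using False by (simp flip: exp_of_nat_mult)
    also have "\<dots> \<le> 3" by (rule exp_le)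
    finally have "real k ^ k * (1 + 1 / real k) ^ k \<le> real k ^ k * 3" by (intro mult_left_mono) auto
    moreover have "real k ^ k * (1 + 1 / real k) ^ k = real (Suc k) ^ k"
      using False by (simp flip: power_mult_distrib add: field_simps)
    ultimately have "real (Suc k ^ k) \<le> real (3 * k ^ k)" by (simp add: mult.commute)
    then have "Suc k ^ k \<le> 3 * k ^ k" by (simp only: of_nat_le_iff)
    also have "\<dots> \<le> 3 * (3 ^ k * fact k)" using Suc by simp
    finally have "Suc k * Suc k ^ k \<le> Suc k * (3 * (3 ^ k * fact k))" by (rule mult_le_mono2)
    then show ?thesis by (simp add: algebra_simps)
  qed simp
qed simp

lemma binomial_mult_le: "(k * s) choose k \<le> (3 * s) ^ k"
proof -
  have "((k * s) choose k) * fact k \<le> (k * s) ^ k" by (rule binomial_fact_pow)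
  also have "\<dots> = k ^ k * s ^ k" by (rule power_mult_distrib)
  also have "\<dots> \<le> (3 ^ k * fact k) * s ^ k" by (intro mult_le_mono1 power_self_le_fact)
  also have "\<dots> = (3 * s) ^ k * fact k" by (simp add: power_mult_distrib)
  finally show ?thesis by simp
qed

text \<open>Lets additive terms of order \<open>k\<close>, caused by rounding in each group, be
  charged to the number of families. Since \<open>k * s \<ge> 2 * k\<close>, comparison with
  \<open>(2 * k) choose 1\<close> suffices.\<close>

lemma le_binomial_mult: "s \<ge> 2 \<Longrightarrow> k \<le> (k * s) choose k"
proof (cases "k = 0")
  case False
  assume s: "s \<ge> 2"
  have "k * 1 \<le> k * (s - 1)" using s by (intro mult_le_mono2) simp
  then have "k * s \<ge> k + k" using s by (simp add: algebra_simps diff_mult_distrib2)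
  then have "k + k choose k \<le> (k * s) choose k" by (rule binomial_right_mono)
  moreover have "k \<le> (k + k) choose k"
  proof -
    have "(k + k) choose 1 \<le> (k + k) choose k" using False by (intro binomial_mono) auto
    then show ?thesis by simp
  qed
  ultimately show ?thesis by simp
qed simp

text \<open>The graph has \<open>m\<close> arcs; \<open>2 * d\<close> is essentially its average degree.\<close>

lemma ex_parameters:
  fixes n m :: nat
  assumes n: "n \<ge> 2" and m: "72 * n < m" "m \<le> n * n"
  obtains d k s where "k \<ge> 1" "s \<ge> 2" "d \<ge> 1" "n \<le> d ^ Suc k" "2 * d * n < m"
    "m \<le> 72 * n * s\<^sup>2" "((k * s) choose k)\<^sup>2 \<le> n"
proof -
  \<comment> \<open>Dividing \<open>m - 1\<close> rather than \<open>m\<close> yields the strict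
    inequality \<open>2 * d * n < m\<close> that the Moore bound asks for.\<close>
  define d where "d = (m - 1) div (2 * n)"
  have d1: "d * (2 * n) \<le> m - 1" by (simp add: d_def)
  have d2: "m - 1 < (d + 1) * (2 * n)"
    using n dividend_less_div_times[of "2 * n" "m - 1"] by (simp add: d_def)
  have d36: "36 \<le> d"
  proof -
    have "36 * (2 * n) \<le> m - 1" using m by simp
    then show ?thesis using n unfolding d_def by (simp add: less_eq_div_iff_mult_less_eq)
  qed
  have dm: "2 * d * n < m" using d1 m by (simp add: mult_ac)
  have md: "m \<le> 2 * n * (d + 1)" using d2 by (simp add: mult_ac)
  have "d * n < n * n" using dm m(2) by linarith
  then have dn: "d < n" by simp
  define j where "j = (LEAST j. n \<le> d ^ j)"
  have "n < 2 ^ n" by (rule less_exp)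
  also have "(2 :: nat) ^ n \<le> d ^ n" using d36 by (intro power_mono) auto
  finally have "n \<le> d ^ n" by simp
  then have j: "n \<le> d ^ j" unfolding j_def by (rule LeastI)
  have "j \<noteq> 0" using j n by (intro notI) simp
  moreover have "j \<noteq> 1" using j dn by (intro notI) simp
  ultimately have "j \<ge> 2" by simp
  then obtain k where k: "j = Suc k" "k \<ge> 1" by (cases j) auto
  have dk: "d ^ k < n" using not_less_Least[of k "\<lambda>j. n \<le> d ^ j"] k by (simp add: j_def)
  \<comment> \<open>This is \<open>sqrt d / 3\<close> rounded down; the \<open>9\<close> is the
    square of the \<open>3\<close> in \<open>binomial_mult_le\<close>.\<close>
  define s where "s = (LEAST s. d < 9 * (s + 1)\<^sup>2)"
  have "d < 9 * (d + 1)\<^sup>2" by (simp add: power2_eq_square)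
  then have s: "d < 9 * (s + 1)\<^sup>2" unfolding s_def by (rule LeastI)
  \<comment> \<open>Uses \<open>d \<ge> 36 = 9 * 2 ^ 2\<close>, the reason for the threshold
    \<open>72 * n\<close> on the number of arcs.\<close>
  have s2: "s \<ge> 2"
  proof (rule ccontr)
    assume "\<not> ?thesis"
    then have "(s + 1)\<^sup>2 \<le> 2\<^sup>2" by (intro power_mono) auto
    then show False using s d36 by simp
  qed
  then have "\<not> d < 9 * (s - 1 + 1)\<^sup>2"
    unfolding s_def by (intro not_less_Least) simp
  then have sd: "9 * s\<^sup>2 \<le> d" using s2 by simp
  have "(s + 1)\<^sup>2 \<le> (2 * s)\<^sup>2" using s2 by (intro power_mono) auto
  then have "d + 1 \<le> 36 * s\<^sup>2" using s by (simp add: power_mult_distrib)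
  then have "2 * n * (d + 1) \<le> 2 * n * (36 * s\<^sup>2)" by (rule mult_le_mono2)
  with md have ms: "m \<le> 72 * n * s\<^sup>2" by (simp add: mult_ac)
  have "((k * s) choose k)\<^sup>2 \<le> ((3 * s) ^ k)\<^sup>2" by (intro power_mono binomial_mult_le) simp
  also have "\<dots> = (9 * s\<^sup>2) ^ k" 
  proof -
    have "((3 * s) ^ k)\<^sup>2 = ((3 * s)\<^sup>2) ^ k" by (metis power_mult mult.commute)
    then show ?thesis by (simp add: power_mult_distrib)
  qed
  also have "\<dots> \<le> d ^ k" using sd by (rule power_mono) simp
  finally have "((k * s) choose k)\<^sup>2 \<le> n" using dk by simp
  then show thesis using that[of k s d] k s2 d36 j dm ms by simp
qed

text \<open>There are \<open>t\<close> blocks of \<open>r\<close> processors, and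
  \<open>total\<close> stands for the number of arcs into \<open>T\<close>. From
  \<open>n < t * (r + 1)\<close> and \<open>t \<le> r\<close> follow
  \<open>n \<le> 2 * t * r\<close> and \<open>q \<le> 2 * r\<close>. After division by
  \<open>r\<close> the main term \<open>72 * n\<close> gives \<open>144 * t\<close>, the excess
  \<open>k * (4 + 4 * q)\<close> gives \<open>12 * t\<close>, and rounding adds
  \<open>2 * k \<le> 2 * t\<close>: in all \<open>158 * t\<close>.\<close>

lemma load_bound:
  fixes n m k s q total :: nat
  defines "t \<equiv> (k * s) choose k"
  defines "r \<equiv> n div t"
  assumes s: "s \<ge> 2" and k: "k \<ge> 1" and n: "n \<ge> 1" and tn: "t\<^sup>2 \<le> n" and q: "(q - 1)\<^sup>2 \<le> n"
    and m: "m \<le> 72 * n * s\<^sup>2"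
    and total: "total \<le> k * (m div (k * s) + 1 + 2 * q + 2)"
  shows "1 \<le> t" "t \<le> r" "1 \<le> r" "t * r \<le> n" "2 * q \<le> 4 * r"
    "k * ((total div (k * s) + 1 + 2 * q) div r + 2) \<le> 158 * t"
proof -
  have kt: "k \<le> t" unfolding t_def using s by (rule le_binomial_mult)
  then show t1: "1 \<le> t" using k by simp
  show tr: "t \<le> r"
    using tn t1 by (simp add: r_def less_eq_div_iff_mult_less_eq power2_eq_square)
  then show r1: "1 \<le> r" using t1 by simp
  show "t * r \<le> n" by (simp add: r_def)
  have ntr: "n < t * (r + 1)"
    using t1 dividend_less_times_div[of t n] by (simp add: r_def)
  also have "\<dots> \<le> (r + 1) * (r + 1)" using tr by (intro mult_le_mono1) simp
  finally have "(q - 1)\<^sup>2 < (r + 1)\<^sup>2" using q by (simp add: power2_eq_square)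
  then have "q - 1 < r + 1" by (rule power_less_imp_less_base) simp
  then have qr: "q \<le> 2 * r" using r1 by linarith
  then show "2 * q \<le> 4 * r" by simp
  have "t * (r + 1) \<le> t * (2 * r)" using r1 by (intro mult_le_mono2) simp
  with ntr have "n \<le> t * (2 * r)" by (rule less_imp_le[OF less_le_trans])
  then have n2: "n \<le> 2 * t * r" by (simp add: mult_ac)
  let ?b = "total div (k * s) + 1"
  have "s * total \<le> s * (k * (m div (k * s) + 1 + 2 * q + 2))" using total by (rule mult_le_mono2)
  also have "\<dots> = (k * s) * (m div (k * s)) + s * k * (3 + 2 * q)" by (simp add: algebra_simps)
  also have "\<dots> \<le> m + s * k * (3 + 2 * q)" by simp
  also have "\<dots> \<le> 72 * n * s\<^sup>2 + s * (s * k * (3 + 2 * q))" using m s by (intro add_mono) auto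
  finally have st: "s * total \<le> s * (s * (72 * n + k * (3 + 2 * q)))"
    by (simp add: algebra_simps power2_eq_square)
  then have st: "total \<le> s * (72 * n + k * (3 + 2 * q))" using s by simp
  have "s * (k * ?b) = (k * s) * (total div (k * s)) + s * k" by (simp add: algebra_simps)
  also have "\<dots> \<le> total + s * k" by simp
  also have "\<dots> \<le> s * (72 * n + k * (4 + 2 * q))" using st by (simp add: algebra_simps)
  finally have "k * ?b \<le> 72 * n + k * (4 + 2 * q)" using s by simp
  then have "k * (?b + 2 * q) \<le> 72 * n + k * (4 + 4 * q)" by (simp add: algebra_simps)
  also have "\<dots> \<le> 72 * (2 * t * r) + k * (12 * r)"
    using n2 qr r1 by (intro add_mono mult_le_mono2) auto
  also have "\<dots> \<le> (156 * t) * r" using kt mult_le_mono1[OF kt, of r] by (simp add: algebra_simps)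
  finally have *: "k * (?b + 2 * q) \<le> (156 * t) * r" .
  have "k * ((?b + 2 * q) div r) * r \<le> k * (?b + 2 * q)" 
    by (simp only: mult.assoc) (intro mult_le_mono2 div_times_less_eq_dividend)
  then have "k * ((?b + 2 * q) div r) * r \<le> (156 * t) * r" using * by (rule le_trans)
  then have "k * ((?b + 2 * q) div r) \<le> 156 * t" using r1 by simp
  then show "k * ((?b + 2 * q) div r + 2) \<le> 158 * t" using kt by (simp add: algebra_simps)
qed

section \<open>Covering a short cycle\<close>

text \<open>Determined by \<open>k\<close> and \<open>g\<close> alone, so all processors agree on
  which family has number \<open>T\<close>.\<close>

definition subset_enum :: "nat \<Rightarrow> nat \<Rightarrow> nat \<Rightarrow> nat set" where
  "subset_enum k g = (SOME e. bij_betw e {0..<g choose k} {X. X \<subseteq> {..<g} \<and> card X = k})"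

lemma bij_betw_subset_enum:
  "bij_betw (subset_enum k g) {0..<g choose k} {X. X \<subseteq> {..<g} \<and> card X = k}"
proof -
  have "finite {X. X \<subseteq> {..<g} \<and> card X = k}" by simp
  moreover have "card {X. X \<subseteq> {..<g} \<and> card X = k} = g choose k" by (simp add: n_subsets)
  ultimately have "\<exists>e. bij_betw e {0..<g choose k} {X. X \<subseteq> {..<g} \<and> card X = k}"
    using ex_bij_betw_nat_finite by metis
  then show ?thesis unfolding subset_enum_def by (rule someI_ex)
qed

lemma subset_enum:
  assumes "T < g choose k"
  shows "finite (subset_enum k g T)" "card (subset_enum k g T) = k"
  using bij_betwE[OF bij_betw_subset_enum[of k g]] assms finite_subset[of _ "{..<g}"] by auto

lemma subset_enum_covers:
  assumes "J \<subseteq> {..<g}" "card J \<le> k" "k \<le> g"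
  obtains T where "T < g choose k" "J \<subseteq> subset_enum k g T"
proof -
  obtain B where "J \<subseteq> B" "B \<subseteq> {..<g}" "card B = k"
    using exists_subset_between[of J k "{..<g}"] assms by auto
  moreover from this have "B \<in> subset_enum k g ` {0..<g choose k}"
    using bij_betw_subset_enum[of k g] by (auto simp: bij_betw_def)
  ultimately show thesis using that by auto
qed

text \<open>The \<open>+ 1\<close> in the quota makes \<open>g\<close> quotas exceed the total, so
  no vertex falls into a group beyond the last.\<close>

lemma group_index_less:
  fixes w :: "nat \<Rightarrow> nat"
  assumes "v < n" "g \<ge> 1"
  shows "sum w {..<v} div (sum w {..<n} div g + 1) < g"
proof -
  have "sum w {..<v} \<le> sum w {..<n}" using assms(1) by (intro prefix_sum_mono) simp
  also have "\<dots> < g * (sum w {..<n} div g + 1)"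
    using assms(2) dividend_less_times_div[of g "sum w {..<n}"] by simp
  finally show ?thesis by (simp add: div_less_iff_less_mult)
qed

text \<open>Every arc of a cycle joins a vertex at an even position to the successor of a vertex at an
  even position, also when the length is odd.\<close>

lemma cycle_cover:
  assumes cyc: "is_cycle E vs" and len: "length vs \<le> 2 * k"
  obtains P Q where "finite P" "card P \<le> k" "finite Q" "card Q \<le> k" "P \<subseteq> set vs" "Q \<subseteq> set vs"
    "\<And>i. i < length vs \<Longrightarrow> vs ! i \<in> P \<and> vs ! (Suc i mod length vs) \<in> Q \<or>
       vs ! i \<in> Q \<and> vs ! (Suc i mod length vs) \<in> P"
proof -
  let ?l = "length vs"
  define I where "I = {i. i < ?l \<and> even i}"
  have "I \<subseteq> (\<lambda>j. 2 * j) ` {..<k}"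
  proof
    fix i assume "i \<in> I"
    then have "i = 2 * (i div 2)" "i div 2 < k" using len by (auto simp: I_def)
    then show "i \<in> (\<lambda>j. 2 * j) ` {..<k}" by blast
  qed
  then have fin: "finite I" and "card I \<le> card ((\<lambda>j. 2 * j) ` {..<k})"
    by (auto intro: finite_subset card_mono)
  then have cardI: "card I \<le> k" by (simp add: card_image inj_on_def)
  have l: "0 < ?l" using cyc by (auto simp: is_cycle_def)
  let ?P = "(\<lambda>i. vs ! i) ` I" and ?Q = "(\<lambda>i. vs ! (Suc i mod ?l)) ` I"
  have ev: "vs ! i \<in> ?P \<and> vs ! (Suc i mod ?l) \<in> ?Q \<or> vs ! i \<in> ?Q \<and> vs ! (Suc i mod ?l) \<in> ?P"
    if i: "i < ?l" for i
  proof (cases "even i")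
    case True
    then show ?thesis using i by (auto simp: I_def)
  next
    case False
    then obtain j where j: "i = Suc j" "even j" by (cases i) auto
    then have "j \<in> I" "vs ! (Suc j mod ?l) = vs ! i" using i by (auto simp: I_def)
    then have "vs ! i \<in> ?Q" by (metis imageI)
    \<comment> \<open>The successor of an odd position is even, and the last position wraps around
      to \<open>0\<close>.\<close>
    moreover have "Suc i mod ?l \<in> I"
      using i l False by (cases "Suc i = ?l") (auto simp: I_def)
    ultimately show ?thesis by auto
  qed
  show thesis
  proof (rule that[of ?P ?Q])
    show "card ?P \<le> k" "card ?Q \<le> k" using cardI card_image_le[OF fin] le_trans by blast+
  qed (use fin l ev in \<open>auto simp: I_def\<close>)
qed

section \<open>The algorithm\<close>

definition root_up :: "nat \<Rightarrow> nat" where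
  "root_up n = (LEAST q. n \<le> q\<^sup>2)"

lemma root_up: "n \<le> (root_up n)\<^sup>2" "(root_up n - 1)\<^sup>2 \<le> n"
proof -
  have "n \<le> n\<^sup>2" by (simp add: power2_eq_square)
  then show "n \<le> (root_up n)\<^sup>2" unfolding root_up_def by (rule LeastI)
  show "(root_up n - 1)\<^sup>2 \<le> n"
  proof (cases "root_up n")
    case (Suc q)
    then have "\<not> n \<le> q\<^sup>2" using not_less_Least[of q "\<lambda>q. n \<le> q\<^sup>2"] by (simp add: root_up_def)
    then show ?thesis using Suc by simp
  qed simp
qed

text \<open>All parameters are functions of \<open>n\<close> and of the degree sequence \<open>\<delta>\<close>, hence known to every
  processor after one round.\<close>

definition high :: "nat \<Rightarrow> (nat \<Rightarrow> nat) \<Rightarrow> nat set" where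
  "high n \<delta> = {v. v < n \<and> 2 * root_up n < \<delta> v}"

definition valid_params :: "nat \<Rightarrow> nat \<Rightarrow> nat \<times> nat \<Rightarrow> bool" where
  "valid_params n m = (\<lambda>(k, s). k \<ge> 1 \<and> s \<ge> 2 \<and> (\<exists>d\<ge>1. n \<le> d ^ Suc k \<and> 2 * d * n < m) \<and>
     m \<le> 72 * n * s\<^sup>2 \<and> ((k * s) choose k)\<^sup>2 \<le> n)"

definition params :: "nat \<Rightarrow> (nat \<Rightarrow> nat) \<Rightarrow> nat \<times> nat" where
  "params n \<delta> = (SOME x. valid_params n (\<Sum>v<n. \<delta> v) x)"

definition half_len :: "nat \<Rightarrow> (nat \<Rightarrow> nat) \<Rightarrow> nat" where
  "half_len n \<delta> = fst (params n \<delta>)"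

definition num_groups :: "nat \<Rightarrow> (nat \<Rightarrow> nat) \<Rightarrow> nat" where
  "num_groups n \<delta> = fst (params n \<delta>) * snd (params n \<delta>)"

definition num_blocks :: "nat \<Rightarrow> (nat \<Rightarrow> nat) \<Rightarrow> nat" where
  "num_blocks n \<delta> = num_groups n \<delta> choose half_len n \<delta>"

definition block_size :: "nat \<Rightarrow> (nat \<Rightarrow> nat) \<Rightarrow> nat" where
  "block_size n \<delta> = n div num_blocks n \<delta>"

definition group_of :: "nat \<Rightarrow> nat \<Rightarrow> (nat \<Rightarrow> nat) \<Rightarrow> nat \<Rightarrow> nat" where
  "group_of n g w v = sum w {..<v} div (sum w {..<n} div g + 1)"

definition chosen :: "nat \<Rightarrow> (nat \<Rightarrow> nat) \<Rightarrow> nat \<Rightarrow> nat set" where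
  "chosen n \<delta> = subset_enum (half_len n \<delta>) (num_groups n \<delta>)"

text \<open>Vertices of high degree get weight \<open>0\<close>, as their arcs are public. The
  remaining weights are at most \<open>2 * root_up n\<close>, which limits the excess of a
  group.\<close>

definition low_degree :: "nat \<Rightarrow> (nat \<Rightarrow> nat) \<Rightarrow> nat \<Rightarrow> nat" where
  "low_degree n \<delta> y = (if y \<in> high n \<delta> then 0 else \<delta> y)"

definition column :: "nat \<Rightarrow> (nat \<Rightarrow> nat) \<Rightarrow> nat set \<Rightarrow> nat \<Rightarrow> nat \<Rightarrow> nat set" where
  "column n \<delta> X v T = (if v \<in> high n \<delta> then {} else
     {y \<in> X. y \<notin> high n \<delta> \<and> group_of n (num_groups n \<delta>) (low_degree n \<delta>) y \<in> chosen n \<delta> T})"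

text \<open>The weights \<open>w\<close> are a parameter because this grouping is redone for every
  column family.\<close>

definition in_row :: "nat \<Rightarrow> (nat \<Rightarrow> nat) \<Rightarrow> (nat \<Rightarrow> nat) \<Rightarrow> nat \<Rightarrow> nat \<Rightarrow> bool" where
  "in_row n \<delta> w v T \<longleftrightarrow> group_of n (num_groups n \<delta>) w v \<in> chosen n \<delta> T"

section \<open>Load and correctness on a fixed graph\<close>

locale simple_graph_on =
  fixes n :: nat and E :: "nat rel"
  assumes irr: "irrefl E" and sym: "sym E" and sub: "E \<subseteq> {..<n} \<times> {..<n}"
begin

definition deg :: "nat \<Rightarrow> nat" where "deg v = card (E `` {v})"

definition weight :: "nat \<Rightarrow> nat \<Rightarrow> nat" where
  "weight T v = (if v < n then card (column n deg (E `` {v}) v T) else 0)"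

definition task_arcs :: "nat \<Rightarrow> nat \<Rightarrow> nat rel" where
  "task_arcs T T' = {(v, y). v < n \<and> y \<in> column n deg (E `` {v}) v T \<and> in_row n deg (weight T) v T'}"

definition high_arcs :: "nat rel" where
  "high_arcs = {(v, y). v < n \<and> y \<in> (if v \<in> high n deg then E `` {v} else {})}"

text \<open>The knowledge of processor \<open>T * r + T'\<close>. Task arcs run from
  \<open>T'\<close> into \<open>T\<close>, whereas a cycle also passes from \<open>T\<close> to
  \<open>T'\<close>, hence the converses.\<close>

definition known_arcs :: "nat \<Rightarrow> nat \<Rightarrow> nat rel" where
  "known_arcs T T' = task_arcs T T' \<union> (task_arcs T T')\<inverse> \<union> high_arcs \<union> high_arcs\<inverse>"

lemma nbrs: "E `` {v} \<subseteq> {..<n}" "finite (E `` {v})"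
  using sub finite_subset[of "E `` {v}" "{..<n}"] by auto

lemma sum_deg: "(\<Sum>v<n. deg v) = card E"
proof -
  have "E = (SIGMA v:{..<n}. E `` {v})" using sub by auto
  then have "card E = card (SIGMA v:{..<n}. E `` {v})" by simp
  also have "\<dots> = (\<Sum>v<n. deg v)" using nbrs(2) by (simp add: deg_def)
  finally show ?thesis by simp
qed

lemma known_arcs_subset: "known_arcs T T' \<subseteq> E"
proof -
  have "task_arcs T T' \<subseteq> E" by (auto simp: task_arcs_def column_def split: if_splits)
  moreover have "high_arcs \<subseteq> E" by (auto simp: high_arcs_def split: if_splits)
  ultimately show ?thesis using sym by (auto simp: known_arcs_def sym_def)
qed

lemma column_bounds:
  assumes "v < n"
  shows "column n deg (E `` {v}) v T \<subseteq> {..<n}" "card (column n deg (E `` {v}) v T) \<le> 2 * root_up n"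
proof -
  show "column n deg (E `` {v}) v T \<subseteq> {..<n}" using nbrs(1) by (auto simp: column_def)
  show "card (column n deg (E `` {v}) v T) \<le> 2 * root_up n"
  proof (cases "v \<in> high n deg")
    case False
    then have "deg v \<le> 2 * root_up n" using assms by (simp add: high_def)
    moreover have "card (column n deg (E `` {v}) v T) \<le> card (E `` {v})"
      by (rule card_mono[OF nbrs(2)]) (auto simp: column_def)
    ultimately show ?thesis by (simp add: deg_def)
  qed (simp add: column_def)
qed

context
  assumes params: "valid_params n (card E) (params n deg)" and n2: "n \<ge> 2"
begin

lemma params_facts:
  obtains s where "snd (params n deg) = s" "num_groups n deg = half_len n deg * s"
    "half_len n deg \<ge> 1" "s \<ge> 2" "card E \<le> 72 * n * s\<^sup>2" "((half_len n deg * s) choose half_len n deg)\<^sup>2 \<le> n"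
  using params that unfolding valid_params_def num_groups_def half_len_def by (auto split: prod.splits)

lemma chosen:
  assumes "T < num_blocks n deg"
  shows "finite (chosen n deg T)" "card (chosen n deg T) = half_len n deg"
  using subset_enum assms by (auto simp: chosen_def num_blocks_def)

text \<open>Double counting: by symmetry each arc into the family \<open>T\<close> is counted at its
  endpoint there, and the groups of that side are balanced by \<open>low_degree\<close>.\<close>

lemma column_total:
  assumes T: "T < num_blocks n deg"
  shows "sum (weight T) {..<n} \<le> half_len n deg *
    (card E div num_groups n deg + 1 + 2 * root_up n + 2)"
proof -
  let ?w = "low_degree n deg" and ?g = "num_groups n deg"
  let ?B = "sum ?w {..<n} div ?g + 1"
  let ?Y = "{y. y < n \<and> sum ?w {..<y} div ?B \<in> chosen n deg T}"
  let ?C = "\<lambda>v. column n deg (E `` {v}) v T"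
  have finC: "finite (?C v)" for v
    by (rule finite_subset[OF _ nbrs(2)[of v]]) (auto simp: column_def)
  have "sum (weight T) {..<n} = (\<Sum>v<n. card (?C v))" by (simp add: weight_def)
  also have "\<dots> = card (SIGMA v:{..<n}. ?C v)" using finC by simp
  also have "\<dots> \<le> card (SIGMA y:?Y. if y \<in> high n deg then {} else E `` {y})"
  proof (rule card_inj_on_le)
    show "inj_on prod.swap (SIGMA v:{..<n}. ?C v)" by simp
    show "prod.swap ` (SIGMA v:{..<n}. ?C v) \<subseteq> (SIGMA y:?Y. if y \<in> high n deg then {} else E `` {y})"
      using sub sym by (auto simp: column_def group_of_def sym_def split: if_splits)
    show "finite (SIGMA y:?Y. if y \<in> high n deg then {} else E `` {y})"
      using nbrs(2) by (intro finite_SigmaI) auto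
  qed
  also have "\<dots> = (\<Sum>y\<in>?Y. card (if y \<in> high n deg then {} else E `` {y}))"
    using nbrs(2) by (intro card_SigmaI) auto
  also have "\<dots> = (\<Sum>y\<in>?Y. ?w y)" by (intro sum.cong) (auto simp: low_degree_def deg_def)
  also have "\<dots> \<le> card (chosen n deg T) * (?B + 2 * root_up n + 2)"
    using chosen(1)[OF T] by (intro sum_group_weights_le) (auto simp: low_degree_def high_def)
  also have "\<dots> = half_len n deg * (?B + 2 * root_up n + 2)" by (simp add: chosen(2)[OF T])
  also have "\<dots> \<le> half_len n deg * (card E div ?g + 1 + 2 * root_up n + 2)"
  proof -
    have "sum ?w {..<n} \<le> card E" unfolding sum_deg[symmetric] by (intro sum_mono) (simp add: low_degree_def)
    then have "?B \<le> card E div ?g + 1" by (simp add: div_le_mono)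
    then show ?thesis by (intro mult_le_mono2) simp
  qed
  finally show ?thesis .
qed

lemma loads:
  assumes T: "T < num_blocks n deg"
  shows "1 \<le> num_blocks n deg" "num_blocks n deg \<le> block_size n deg" "1 \<le> block_size n deg"
    "num_blocks n deg * block_size n deg \<le> n" "2 * root_up n \<le> 4 * block_size n deg"
    "half_len n deg * ((sum (weight T) {..<n} div num_groups n deg + 1 + 2 * root_up n) div block_size n deg + 2)
      \<le> 158 * num_blocks n deg"
proof -
  obtain s where s: "num_groups n deg = half_len n deg * s"
    "half_len n deg \<ge> 1" "s \<ge> 2" "card E \<le> 72 * n * s\<^sup>2" "((half_len n deg * s) choose half_len n deg)\<^sup>2 \<le> n"
    using params_facts by metis
  have "sum (weight T) {..<n} \<le> half_len n deg * (card E div (half_len n deg * s) + 1 + 2 * root_up n + 2)"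
    using column_total[OF T] by (simp only: s(1))
  note b = load_bound[OF s(3,2) _ s(5) root_up(2) s(4) this]
  show "1 \<le> num_blocks n deg" "num_blocks n deg \<le> block_size n deg" "1 \<le> block_size n deg"
    "num_blocks n deg * block_size n deg \<le> n" "2 * root_up n \<le> 4 * block_size n deg"
    "half_len n deg * ((sum (weight T) {..<n} div num_groups n deg + 1 + 2 * root_up n) div block_size n deg + 2)
      \<le> 158 * num_blocks n deg"
    using b n2 by (simp_all only: num_blocks_def block_size_def s(1) le_trans[OF _ n2] one_le_numeral)
qed

lemma num_blocks_pos: "0 < num_blocks n deg"
proof -
  obtain s where s: "num_groups n deg = half_len n deg * s" "half_len n deg \<ge> 1" "s \<ge> 2"
    using params_facts by metis
  have "half_len n deg \<le> num_blocks n deg" unfolding num_blocks_def s(1) using s(3) by (rule le_binomial_mult)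
  then show ?thesis using s(2) by simp
qed

text \<open>Here balancing by \<open>weight T\<close> pays off: each of the \<open>half_len\<close>
  groups of \<open>T'\<close> carries about a \<open>num_groups\<close>-th part of the arcs into
  \<open>T\<close>, and residues of positions divide these evenly among the members of the
  block.\<close>

lemma task_load:
  assumes T: "T < num_blocks n deg" and T': "T' < num_blocks n deg"
  shows "card {(v, x). v < n \<and> x < weight T v \<and> in_row n deg (weight T) v T' \<and>
    (sum (weight T) {..<v} + x) mod block_size n deg = z} \<le> 158 * num_blocks n deg"
proof -
  have "card {(v, x). v < n \<and> x < weight T v \<and> in_row n deg (weight T) v T' \<and>
    (sum (weight T) {..<v} + x) mod block_size n deg = z} \<le> card (chosen n deg T') *
    ((sum (weight T) {..<n} div num_groups n deg + 1 + 2 * root_up n) div block_size n deg + 2)"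
    unfolding in_row_def group_of_def
    by (rule card_group_residue_class_le) (use loads(3)[OF T] column_bounds(2) chosen(1)[OF T'] in \<open>auto simp: weight_def\<close>)
  also have "\<dots> \<le> 158 * num_blocks n deg" using loads(6)[OF T] by (simp only: chosen(2)[OF T'])
  finally show ?thesis .
qed

text \<open>Every arc of the cycle joins \<open>P\<close> and \<open>Q\<close>. If an endpoint has
  high degree, the arc is public; otherwise it is a task arc or the converse of one, for families
  containing the groups of \<open>P\<close> and \<open>Q\<close>.\<close>

lemma short_cycle_known:
  assumes cyc: "is_cycle E vs" and len: "length vs \<le> 2 * half_len n deg"
  obtains T T' where "T < num_blocks n deg" "T' < num_blocks n deg" "is_cycle (known_arcs T T') vs"
proof -
  let ?k = "half_len n deg" and ?g = "num_groups n deg"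
  obtain s where s: "?g = ?k * s" "?k \<ge> 1" "s \<ge> 2" using params_facts by metis
  then have kg: "?k \<le> ?g" "?g \<ge> 1" by auto
  obtain P Q where PQ: "finite P" "card P \<le> ?k" "finite Q" "card Q \<le> ?k" "P \<subseteq> set vs" "Q \<subseteq> set vs"
    "\<And>i. i < length vs \<Longrightarrow> vs ! i \<in> P \<and> vs ! (Suc i mod length vs) \<in> Q \<or>
       vs ! i \<in> Q \<and> vs ! (Suc i mod length vs) \<in> P"
    by (rule cycle_cover[OF cyc len]) blast
  have "vs ! i < n" if "i < length vs" for i using cyc sub that by (auto simp: is_cycle_def)
  then have vsn: "set vs \<subseteq> {..<n}" by (auto simp: in_set_conv_nth)
  have cover: "\<exists>T<num_blocks n deg. group_of n ?g w ` A \<subseteq> chosen n deg T"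
    if A: "finite A" "card A \<le> ?k" "A \<subseteq> set vs" for w A
  proof -
    have "group_of n ?g w ` A \<subseteq> {..<?g}"
    proof
      fix j assume "j \<in> group_of n ?g w ` A"
      then obtain v where "j = group_of n ?g w v" "v < n" using A(3) vsn by auto
      then show "j \<in> {..<?g}" using group_index_less[of v n ?g w] kg by (simp add: group_of_def)
    qed
    moreover have "card (group_of n ?g w ` A) \<le> ?k" using card_image_le[OF A(1)] A(2) le_trans by blast
    ultimately obtain T where "T < ?g choose ?k" "group_of n ?g w ` A \<subseteq> subset_enum ?k ?g T"
      using subset_enum_covers kg(1) by metis
    then show ?thesis by (auto simp: num_blocks_def chosen_def)
  qed
  from cover[OF PQ(1,2,5)] obtain T where T: "T < num_blocks n deg"
    "group_of n ?g (low_degree n deg) ` P \<subseteq> chosen n deg T" by blast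
  \<comment> \<open>The order matters: the groups of \<open>Q\<close> are formed with
    \<open>weight T\<close>, so \<open>T\<close> has to be fixed before \<open>T'\<close>.\<close>
  from cover[OF PQ(3,4,6)] obtain T' where T': "T' < num_blocks n deg"
    "group_of n ?g (weight T) ` Q \<subseteq> chosen n deg T'" by blast
  have known: "(a, b) \<in> known_arcs T T' \<and> (b, a) \<in> known_arcs T T'" if "(a, b) \<in> E" "a \<in> Q" "b \<in> P" for a b
  proof -
    have ab: "a < n" "b < n" "(b, a) \<in> E" using that(1) sub symD[OF sym] by auto
    consider "a \<in> high n deg" | "b \<in> high n deg" | "a \<notin> high n deg" "b \<notin> high n deg" by blast
    then show ?thesis
    proof cases
      case 1
      then have "(a, b) \<in> high_arcs" using that(1) ab by (simp add: high_arcs_def)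
      then show ?thesis by (simp add: known_arcs_def)
    next
      case 2
      then have "(b, a) \<in> high_arcs" using ab by (simp add: high_arcs_def)
      then show ?thesis by (simp add: known_arcs_def)
    next
      case 3
      then have "b \<in> column n deg (E `` {a}) a T" using that T(2) by (auto simp: column_def)
      moreover have "in_row n deg (weight T) a T'" using that T'(2) by (auto simp: in_row_def)
      ultimately have "(a, b) \<in> task_arcs T T'" using ab by (simp add: task_arcs_def)
      then show ?thesis by (simp add: known_arcs_def)
    qed
  qed
  have "(vs ! i, vs ! (Suc i mod length vs)) \<in> known_arcs T T'" if "i < length vs" for i
  proof -
    have e: "(vs ! i, vs ! (Suc i mod length vs)) \<in> E" using cyc that by (simp add: is_cycle_def)
    then show ?thesis using PQ(7)[OF that] known[OF e] known[OF symD[OF sym e]] by blast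
  qed
  then have "is_cycle (known_arcs T T') vs" using cyc by (simp add: is_cycle_def)
  then show thesis using that T(1) T'(1) by blast
qed

end

text \<open>Finite girths lie between \<open>3\<close> and \<open>n\<close>. So they fit into a
  message, and \<open>0\<close> is free to encode that no cycle is known.\<close>

lemma rel_girth_le_n:
  assumes "rel_girth E' \<noteq> \<infinity>" "E' \<subseteq> E"
  shows "\<exists>l\<le>n. l \<ge> 3 \<and> rel_girth E' = enat l"
proof -
  obtain vs where vs: "is_cycle E' vs" "rel_girth E' = enat (length vs)"
    using rel_girth_attained[OF assms(1)] by blast
  have "vs ! i < n" if "i < length vs" for i
  proof -
    have "(vs ! i, vs ! (Suc i mod length vs)) \<in> E" using vs(1) assms(2) that by (auto simp: is_cycle_def)
    then show ?thesis using sub by auto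
  qed
  then have "set vs \<subseteq> {..<n}" by (auto simp: in_set_conv_nth)
  then have "card (set vs) \<le> n" using card_mono[of "{..<n}"] by fastforce
  then have "length vs \<le> n" using vs(1) by (simp add: is_cycle_def distinct_card)
  then show ?thesis using vs by (auto simp: is_cycle_def)
qed

end

section \<open>Assembling the algorithm and its output\<close>

lemma simple_graph_on_cc_input:
  assumes "cc_input n G"
  shows "simple_graph_on n (parcs G)"
proof -
  have "pair_graph G" and V: "pverts G = {..<n}" using assms by (simp_all add: cc_input_def)
  then interpret pair_graph G by simp
  show ?thesis
  proof
    show "irrefl (parcs G)" using pair_no_loops by (fastforce simp: irrefl_def)
    show "sym (parcs G)" using pair_sym_arcs by (simp add: symmetric_def)
    show "parcs G \<subseteq> {..<n} \<times> {..<n}"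
    proof (rule subrelI)
      fix u v assume "(u, v) \<in> parcs G"
      then show "(u, v) \<in> {..<n} \<times> {..<n}" using in_arcsD1[of u v] in_arcsD2[of u v] V by simp
    qed
  qed
qed

lemma neighbours_eq: "neighbours G v = parcs G `` {v}"
  by (auto simp: neighbours_def)

definition degrees :: "nat pair_pre_digraph \<Rightarrow> nat \<Rightarrow> nat" where
  "degrees G v = card (neighbours G v)"

lemma degrees_eq: "cc_input n G \<Longrightarrow> degrees G = simple_graph_on.deg (parcs G)"
  using simple_graph_on.deg_def[OF simple_graph_on_cc_input] by (auto simp: degrees_def neighbours_eq)

lemma cc_computable_degrees: "cc_computable (\<lambda>n G _. degrees G)"
proof -
  have "cc_computable (\<lambda>n G v (p :: nat). card (neighbours G v))"
    by (rule cc_computable_local[OF cc_computable_neighbours])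
  from cc_computable_exchange_nat[OF this, of 2] show ?thesis
  proof (rule cc_computable_cong, intro ext)
    fix n G v u assume inp: "cc_input n G"
    interpret simple_graph_on n "parcs G" using inp by (rule simple_graph_on_cc_input)
    show "(if u < n \<and> card (neighbours G u) < n\<^sup>2 then card (neighbours G u) else 0) = degrees G u"
    proof (cases "u < n")
      case True
      \<comment> \<open>Leaving out \<open>u\<close> itself makes the degree less than
        \<open>n\<close>, hence less than \<open>n ^ 2\<close> even for \<open>n = 1\<close>, and
        nothing is clipped.\<close>
      have "parcs G `` {u} \<subseteq> {..<n} - {u}" using nbrs(1) irr by (auto simp: irrefl_def)
      then have "card (neighbours G u) \<le> card ({..<n} - {u})"
        unfolding neighbours_eq by (rule card_mono[rotated]) simp
      also have "\<dots> < n" using True by simp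
      also have "n \<le> n\<^sup>2" by (simp add: power2_eq_square)
      finally show ?thesis using True by (simp add: degrees_def)
    next
      case False
      then have "neighbours G u = {}" using sub by (auto simp: neighbours_eq)
      then show ?thesis using False by (simp add: degrees_def)
    qed
  qed
qed

lemma rel_girth_empty: "rel_girth ({} :: 'a rel) = \<infinity>"
proof -
  have "\<not> is_cycle {} vs" for vs :: "'a list" by (force simp: is_cycle_def)
  then have "\<infinity> \<le> rel_girth ({} :: 'a rel)" by (intro rel_girth_greatest) blast
  then show ?thesis by simp
qed

text \<open>\<open>V u\<close> is the length reported by \<open>u\<close>, with \<open>0\<close> for
  none; if nobody reports a cycle, the infimum is infinite and the cap
  \<open>2 * half_len n \<delta> + 1\<close> is returned. The value \<open>3\<close> stands for
  girth \<open>3\<close> or \<open>4\<close>.\<close>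

definition decide :: "nat \<Rightarrow> (nat \<Rightarrow> nat) \<Rightarrow> nat rel \<Rightarrow> (nat \<Rightarrow> nat) \<Rightarrow> enat" where
  "decide n \<delta> E V =
     (if n < 2 then \<infinity>
      else if (\<Sum>v<n. \<delta> v) \<le> 72 * n then rel_girth E
      else if (\<Sum>v\<in>high n \<delta>. \<delta> v) > 2 * n then 3
      else min (INF u \<in> {u. V u \<noteq> 0}. enat (V u)) (enat (2 * half_len n \<delta> + 1)))"

lemma cc_computable_girth:
  obtains out where "cc_computable out"
    "\<And>n G. cc_input n G \<Longrightarrow> \<exists>a. (\<forall>v<n. out n G v = a) \<and> girth G \<in> {a, a + 1}"
proof -
  have N: "cc_computable (\<lambda>n G v. column n (degrees G) (neighbours G v) v)"
    by (rule cc_computable_local2[OF cc_computable_neighbours cc_computable_degrees])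
  have t: "cc_computable (\<lambda>n G _. num_blocks n (degrees G))"
    by (rule cc_computable_local[OF cc_computable_degrees])
  have r: "cc_computable (\<lambda>n G _. block_size n (degrees G))"
    by (rule cc_computable_local[OF cc_computable_degrees])
  have Sel: "cc_computable (\<lambda>n G _. in_row n (degrees G))"
    by (rule cc_computable_local[OF cc_computable_degrees])
  have A1: "cc_computable (\<lambda>n G v. if v \<in> high n (degrees G) then neighbours G v else {})"
    by (rule cc_computable_local2[OF cc_computable_degrees cc_computable_neighbours])
  obtain f0 where f0: "cc_computable f0"
    and f0_eq: "\<And>n G p. cc_input n G \<Longrightarrow> n \<ge> 2 \<Longrightarrow> p < n \<Longrightarrow> (\<And>v. v < n \<Longrightarrow> neighbours G v \<subseteq> {..<n}) \<Longrightarrow>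
       (\<Sum>v<n. card (neighbours G v)) \<le> 72 * n \<Longrightarrow> f0 n G p = {(v, y). v < n \<and> y \<in> neighbours G v}"
    by (rule cc_computable_public_arcs[OF cc_computable_neighbours, of 72]) blast
  obtain f1 where f1: "cc_computable f1"
    and f1_eq: "\<And>n G p. cc_input n G \<Longrightarrow> n \<ge> 2 \<Longrightarrow> p < n \<Longrightarrow>
       (\<And>v. v < n \<Longrightarrow> (if v \<in> high n (degrees G) then neighbours G v else {}) \<subseteq> {..<n}) \<Longrightarrow>
       (\<Sum>v<n. card (if v \<in> high n (degrees G) then neighbours G v else {})) \<le> 2 * n \<Longrightarrow>
       f1 n G p = {(v, y). v < n \<and> y \<in> (if v \<in> high n (degrees G) then neighbours G v else {})}"
    by (rule cc_computable_public_arcs[OF A1, of 2]) blast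
  obtain f2 where f2: "cc_computable f2"
    and f2_eq: "\<And>n G w T T'. cc_input n G \<Longrightarrow> n \<ge> 2 \<Longrightarrow>
      num_blocks n (degrees G) \<le> block_size n (degrees G) \<Longrightarrow> block_size n (degrees G) \<ge> 1 \<Longrightarrow>
      num_blocks n (degrees G) * block_size n (degrees G) \<le> n \<Longrightarrow>
      (\<And>T v. w T v = (if v < n then card (column n (degrees G) (neighbours G v) v T) else 0)) \<Longrightarrow>
      (\<And>v T. v < n \<Longrightarrow> T < num_blocks n (degrees G) \<Longrightarrow> column n (degrees G) (neighbours G v) v T \<subseteq> {..<n} \<and>
        card (column n (degrees G) (neighbours G v) v T) \<le> 4 * block_size n (degrees G)) \<Longrightarrow>
      (\<And>T T' z. T < num_blocks n (degrees G) \<Longrightarrow> T' < num_blocks n (degrees G) \<Longrightarrow> z < block_size n (degrees G) \<Longrightarrow>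
         card {(v, x). v < n \<and> x < w T v \<and> in_row n (degrees G) (w T) v T' \<and>
           (sum (w T) {..<v} + x) mod block_size n (degrees G) = z} \<le> 158 * num_blocks n (degrees G)) \<Longrightarrow>
      T < num_blocks n (degrees G) \<Longrightarrow> T' < num_blocks n (degrees G) \<Longrightarrow>
      f2 n G (T * block_size n (degrees G) + T') =
        {(v, y). v < n \<and> y \<in> column n (degrees G) (neighbours G v) v T \<and> in_row n (degrees G) (w T) v T'}"
    \<comment> \<open>\<open>4\<close> comes from \<open>2 * root_up n \<le> 4 * block_size\<close>,
      and \<open>158\<close> from \<open>load_bound\<close>.\<close>
    by (rule cc_computable_collect[OF N t r Sel, of 4 158]) blast
  \<comment> \<open>\<open>f2\<close> is specified only for numbers \<open>T * r + T'\<close> with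
    both indices below the number of blocks. The other processors contribute nothing, so no false
    arcs enter.\<close>
  define L where "L = (\<lambda>n G p.
    if p div block_size n (degrees G) < num_blocks n (degrees G) \<and> p mod block_size n (degrees G) < num_blocks n (degrees G)
    then f2 n G p \<union> (f2 n G p)\<inverse> \<union> f1 n G p \<union> (f1 n G p)\<inverse> else {})"
  have L: "cc_computable L"
    unfolding L_def by (rule cc_computable_local3[OF f2 f1 cc_computable_degrees])
  define M where "M = (\<lambda>n G p (u :: nat). case rel_girth (L n G p) of enat l \<Rightarrow> l | \<infinity> \<Rightarrow> 0)"
  have M: "cc_computable M" unfolding M_def by (rule cc_computable_local[OF L])
  define V where "V = (\<lambda>n G p u. if u < n \<and> M n G u p < n\<^sup>2 then M n G u p else 0)"
  have V: "cc_computable V" unfolding V_def by (rule cc_computable_exchange_nat[OF M])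
  define out where "out = (\<lambda>n G p. decide n (degrees G) (f0 n G p) (V n G p))"
  have out: "cc_computable out" unfolding out_def by (rule cc_computable_local3[OF cc_computable_degrees f0 V])
  have correct: "\<exists>a. (\<forall>v<n. out n G v = a) \<and> girth G \<in> {a, a + 1}" if inp: "cc_input n G" for n G
  proof -
    define E where "E = parcs G"
    interpret simple_graph_on n E unfolding E_def using inp by (rule simple_graph_on_cc_input)
    have dg: "degrees G = deg" using degrees_eq[OF inp] by (simp add: E_def)
    have nb: "neighbours G v = E `` {v}" for v by (simp add: neighbours_eq E_def)
    have girth: "girth G = rel_girth E"
      using inp by (simp add: cc_input_def E_def girth_eq_rel_girth)
    consider "n < 2" | "n \<ge> 2" "card E \<le> 72 * n"
      | "n \<ge> 2" "card E > 72 * n" "(\<Sum>v\<in>high n deg. deg v) > 2 * n"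
      | "n \<ge> 2" "card E > 72 * n" "(\<Sum>v\<in>high n deg. deg v) \<le> 2 * n"
      by linarith
    then show ?thesis
    proof cases
      case 1
      have "E = {}"
      proof (rule ccontr)
        assume "E \<noteq> {}"
        then obtain u v where "(u, v) \<in> E" by auto
        then have "u < n" "v < n" "u \<noteq> v" using sub irr by (auto simp: irrefl_def)
        then show False using 1 by simp
      qed
      then show ?thesis using 1 girth by (intro exI[of _ \<infinity>]) (simp add: out_def decide_def rel_girth_empty)
    next
      case 2
      have "f0 n G p = E" if "p < n" for p
      proof -
        have "f0 n G p = {(v, y). v < n \<and> y \<in> neighbours G v}"
          by (rule f0_eq[OF inp 2(1) that]) (use 2 nbrs(1) sum_deg in \<open>simp_all add: nb flip: deg_def\<close>)
        also have "\<dots> = E" using sub by (auto simp: nb)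
        finally show ?thesis .
      qed
      then show ?thesis using 2 girth
        by (intro exI[of _ "rel_girth E"]) (simp add: out_def decide_def dg sum_deg)
    next
      case 3
      have "rel_girth E \<le> 4"
        using sum_high_degrees_le[OF irr sym sub root_up] 3(3)
        by (fastforce simp: high_def deg_def)
      then have "rel_girth E \<in> {3, 3 + 1}" using rel_girth_ge_3[of E]
        by (cases "rel_girth E") (auto simp: numeral_eq_enat one_enat_def)
      then show ?thesis using 3 girth
        by (intro exI[of _ 3]) (simp add: out_def decide_def dg sum_deg)
    next
      case 4
      have "card E \<le> n * n"
        using card_mono[OF _ sub] by simp
      then obtain d k s where "k \<ge> 1" "s \<ge> 2" "d \<ge> 1" "n \<le> d ^ Suc k" "2 * d * n < card E"
        "card E \<le> 72 * n * s\<^sup>2" "((k * s) choose k)\<^sup>2 \<le> n"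
        using ex_parameters[OF 4(1,2)] by metis
      then have "valid_params n (card E) (k, s)" by (auto simp: valid_params_def)
      then have par: "valid_params n (card E) (params n deg)"
        unfolding params_def sum_deg by (rule someI)
      let ?t = "num_blocks n deg" and ?r = "block_size n deg" and ?k = "half_len n deg"
      have t0: "0 < ?t" by (rule num_blocks_pos[OF par 4(1)])
      note ld = loads[OF par 4(1) t0]
      have f1_high: "f1 n G p = high_arcs" if "p < n" for p
      proof -
        have "(\<Sum>v<n. card (if v \<in> high n deg then E `` {v} else {})) = (\<Sum>v\<in>high n deg. deg v)"
          by (rule sum.mono_neutral_cong_right) (auto simp: high_def deg_def)
        then show ?thesis unfolding high_arcs_def
          using f1_eq[OF inp 4(1) that, unfolded dg nb] 4(3) nbrs(1) by simp
      qed
      have f2_task: "f2 n G (T * ?r + T') = task_arcs T T'" if "T < ?t" "T' < ?t" for T T'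
        unfolding task_arcs_def
      proof (rule f2_eq[OF inp 4(1), unfolded dg nb])
        show "weight U v = (if v < n then card (column n deg (E `` {v}) v U) else 0)" for U v
          by (rule weight_def)
        show "column n deg (E `` {v}) v U \<subseteq> {..<n} \<and> card (column n deg (E `` {v}) v U) \<le> 4 * ?r"
          if "v < n" for v U
          using column_bounds[OF that, of U] ld(5) by linarith
      qed (use ld(2-4) that task_load[OF par 4(1)] in simp_all)
      have L_known: "L n G p = (if p div ?r < ?t \<and> p mod ?r < ?t then known_arcs (p div ?r) (p mod ?r) else {})"
        if "p < n" for p
        using f2_task[of "p div ?r" "p mod ?r", unfolded div_mult_mod_eq] f1_high[OF that]
        by (simp add: L_def dg known_arcs_def)
      have L_sub: "L n G p \<subseteq> E" if "p < n" for p
        using L_known[OF that] known_arcs_subset by (simp split: if_splits)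
      \<comment> \<open>A processor reports the same length to everyone, so the recipient
        \<open>0\<close> is representative and all outputs agree.\<close>
      define l where "l u = M n G u 0" for u
      have M_l: "M n G u p = l u" for u p by (simp add: M_def l_def)
      have l: "l u \<le> n \<and> (l u \<noteq> 0 \<longrightarrow> rel_girth (L n G u) = enat (l u) \<and> rel_girth E \<le> enat (l u))"
        if "u < n" for u
      proof (cases "rel_girth (L n G u)")
        case (enat x)
        then show ?thesis
          using rel_girth_le_n[OF _ L_sub[OF that]] rel_girth_antimono[OF L_sub[OF that]]
          by (auto simp: l_def M_def)
      qed (simp add: l_def M_def)
      have "n < n\<^sup>2" using 4(1) by (simp add: power2_eq_square)
      then have "l u < n\<^sup>2" if "u < n" for u using l[OF that] by linarith
      then have V_l: "V n G p = (\<lambda>u. if u < n then l u else 0)" for p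
        unfolding V_def M_l by auto
      define g' where "g' = (INF u \<in> {u. u < n \<and> l u \<noteq> 0}. enat (l u))"
      have "(INF u \<in> {u. V n G p u \<noteq> 0}. enat (V n G p u)) = g'" for p
        unfolding g'_def by (rule INF_cong) (auto simp: V_l split: if_splits)
      then have out_eq: "out n G p = min g' (enat (2 * ?k + 1))" for p
        using 4 by (simp add: out_def decide_def dg sum_deg)
      have lower: "rel_girth E \<le> g'" unfolding g'_def using l by (intro INF_greatest) auto
      \<comment> \<open>The Moore bound with exponent \<open>Suc ?k\<close>; by the choice of the
        parameters, \<open>d ^ Suc ?k\<close> reaches \<open>n\<close>.\<close>
      have upper: "rel_girth E \<le> enat (2 * Suc ?k)"
      proof -
        obtain d where d: "d \<ge> 1" "n \<le> d ^ Suc ?k" "2 * d * n < card E"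
          using par by (auto simp: valid_params_def half_len_def split: prod.splits)
        show ?thesis
          by (rule rel_girth_le_if_many_edges[OF irr sym _ sub, of d]) (use d in simp_all)
      qed
      have "rel_girth E \<in> {min g' (enat (2 * ?k + 1)), min g' (enat (2 * ?k + 1)) + 1}"
      proof (cases "rel_girth E \<le> enat (2 * ?k)")
        case True
        then have "rel_girth E \<noteq> \<infinity>" by (cases "rel_girth E") simp_all
        then obtain vs where vs: "is_cycle E vs" "rel_girth E = enat (length vs)"
          by (rule rel_girth_attained)
        then have "length vs \<le> 2 * ?k" using True by simp
        from short_cycle_known[OF par 4(1) vs(1) this]
        obtain T T' where T: "T < ?t" "T' < ?t" "is_cycle (known_arcs T T') vs" by metis
        define u where "u = T * ?r + T'"
        have "T' < ?r" using T(2) ld(2) by simp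
        from mod_less_of_mult_le[OF T(1) this]
        have u: "u < n" "u div ?r = T" "u mod ?r = T'" using ld(4) by (auto simp: u_def)
        have "L n G u = known_arcs T T'" using L_known[OF u(1)] u T by simp
        then have "rel_girth (L n G u) \<le> rel_girth E" using rel_girth_le[OF T(3)] vs(2) by simp
        moreover have "rel_girth E \<le> rel_girth (L n G u)" by (rule rel_girth_antimono[OF L_sub[OF u(1)]])
        ultimately have "rel_girth (L n G u) = enat (length vs)" unfolding vs(2) by (rule antisym)
        then have "l u = length vs" by (simp add: l_def M_def)
        moreover have "length vs \<noteq> 0" using vs(1) by (auto simp: is_cycle_def)
        ultimately have "g' \<le> enat (length vs)" unfolding g'_def
          using u(1) by (intro INF_lower2[of u]) auto
        then have "g' = rel_girth E" using lower vs(2) by simp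
        moreover have "rel_girth E \<le> enat (2 * ?k + 1)"
          by (rule order_trans[OF True]) simp
        ultimately show ?thesis by (simp add: min_def)
      next
        case False
        \<comment> \<open>Reported lengths never fall below the girth, so the cap is the minimum,
          and \<open>upper\<close> leaves only the cap and its successor.\<close>
        then have "rel_girth E \<ge> enat (2 * ?k + 1)" by (cases "rel_girth E") auto
        then have "min g' (enat (2 * ?k + 1)) = enat (2 * ?k + 1)"
          using lower by (intro min.absorb2) (rule order_trans)
        moreover have "rel_girth E \<in> {enat (2 * ?k + 1), enat (2 * ?k + 1) + 1}"
          using False upper by (cases "rel_girth E") (auto simp: one_enat_def)
        ultimately show ?thesis by simp
      qed
      then show ?thesis using girth out_eq by metis
    qed
  qed
  show thesis by (rule that[OF out correct])
qed

theorem theorem1: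
  shows "\<exists>(A :: enat cc_algorithm) (R :: nat) (c :: real). \<forall>(n :: nat) (G :: nat pair_pre_digraph).
    cc_input n G \<longrightarrow>
      cc_bandwidth A n G R (c * log 2 (real n)) \<and>
      (\<exists>a. (\<forall>v<n. cc_output A n G R v = a) \<and> girth G \<in> {a, a + 1})"
proof -
  obtain out where "cc_computable out"
    and girth: "\<And>n G. cc_input n G \<Longrightarrow> \<exists>a. (\<forall>v<n. out n G v = a) \<and> girth G \<in> {a, a + 1}"
    by (rule cc_computable_girth) blast
  then obtain A R c where A: "\<And>n G. cc_input n G \<Longrightarrow>
     cc_bandwidth A n G R (c * log 2 (real n)) \<and> (\<forall>v<n. cc_output A n G R v = out n G v)"
    unfolding cc_computable_def by blast
  show ?thesis
  proof (intro exI allI impI)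
    fix n G assume inp: "cc_input n G"
    obtain a where "\<forall>v<n. out n G v = a" "girth G \<in> {a, a + 1}" using girth[OF inp] by blast
    then show "cc_bandwidth A n G R (c * log 2 (real n)) \<and>
      (\<exists>a. (\<forall>v<n. cc_output A n G R v = a) \<and> girth G \<in> {a, a + 1})"
      using A[OF inp] by auto
  qed
qed

end
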